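(* The $(s,z,t)$-Temporal Separator problem on a temporal graph $G=(V,E,\tau)$ can be approximated within a factor $\tau^2$ in $O((m+n\tau)n\tau^2)$ time, where $n=|V|$ and $m=|E|$.
   Context: A temporal graph $G=(V,E,\tau)$ consists of a finite vertex set $V$ and a set of time-labelled undirected edges $E \subseteq V\times V\times[\tau]$ ($(u,v,t')\in E$ iff $(v,u,t')\in E$, no loops). An $(s,z)$-temporal path is a sequence of edges $(u_1,v_1,t_1),\dots,(u_k,v_k,t_k)$ forming a path from $s$ to $z$ with $t_1\le\dots\le t_k$; its travelling time is $t_k-t_1+1$, and it is an $(s,z,t)$-temporal path if this is at most $t$. An $(s,z,t)$-temporal separator is a set $S\subseteq V\setminus\{s,z\}$ meeting every $(s,z,t)$-temporal path. The $(s,z,t)$-Temporal Separator problem: given $G$, $s,z$ and a positive integer $t$, find a minimum-size $(s,z,t)$-temporal separator. A $\tau^2$-approximation outputs an $(s,z,t)$-temporal separator of size at most $\tau^2$ times the minimum. *)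

theory Defs
  imports Main
begin

section \<open>Temporal graphs and temporal separators\<close>

record 'v temporal_graph =
  verts :: "'v set"
  edges :: "('v \<times> 'v \<times> nat) set"
  lifetime :: nat

definition temporal_graph :: "'v temporal_graph \<Rightarrow> bool" where
  "temporal_graph G \<longleftrightarrow>
     finite (verts G) \<and> 1 \<le> lifetime G \<and>
     edges G \<subseteq> verts G \<times> verts G \<times> {1..lifetime G} \<and>
     (\<forall>u v i. (u, v, i) \<in> edges G \<longleftrightarrow> (v, u, i) \<in> edges G) \<and>
     (\<forall>u i. (u, u, i) \<notin> edges G)"

definition edge_src :: "'v \<times> 'v \<times> nat \<Rightarrow> 'v" where "edge_src e = fst e"
definition edge_tgt :: "'v \<times> 'v \<times> nat \<Rightarrow> 'v" where "edge_tgt e = fst (snd e)"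
definition edge_time :: "'v \<times> 'v \<times> nat \<Rightarrow> nat" where "edge_time e = snd (snd e)"

definition path_verts :: "('v \<times> 'v \<times> nat) list \<Rightarrow> 'v list" where
  "path_verts p = edge_src (hd p) # map edge_tgt p"

text \<open>Labels need not increase strictly along a temporal path; no vertex is repeated.\<close>

definition temporal_path ::
    "'v temporal_graph \<Rightarrow> 'v \<Rightarrow> 'v \<Rightarrow> ('v \<times> 'v \<times> nat) list \<Rightarrow> bool" where
  "temporal_path G s z p \<longleftrightarrow>
     p \<noteq> [] \<and> set p \<subseteq> edges G \<and>
     edge_src (hd p) = s \<and> edge_tgt (last p) = z \<and>
     (\<forall>i. Suc i < length p \<longrightarrow> edge_tgt (p ! i) = edge_src (p ! Suc i)) \<and>
     distinct (path_verts p) \<and>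
     sorted (map edge_time p)"

definition travelling_time :: "('v \<times> 'v \<times> nat) list \<Rightarrow> nat" where
  "travelling_time p = edge_time (last p) - edge_time (hd p) + 1"

definition temporal_separator ::
    "'v temporal_graph \<Rightarrow> 'v \<Rightarrow> 'v \<Rightarrow> nat \<Rightarrow> 'v set \<Rightarrow> bool" where
  "temporal_separator G s z t S \<longleftrightarrow>
     S \<subseteq> verts G - {s, z} \<and>
     (\<forall>p. temporal_path G s z p \<and> travelling_time p \<le> t \<longrightarrow> S \<inter> set (path_verts p) \<noteq> {})"

text \<open>
  There is no separator at all if \<open>s\<close> and \<open>z\<close> are joined by an edge; the next
  definition is meaningful only when some separator exists.
\<close>

definition min_separator_size :: "'v temporal_graph \<Rightarrow> 'v \<Rightarrow> 'v \<Rightarrow> nat \<Rightarrow> nat" where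
  "min_separator_size G s z t = (LEAST k. \<exists>S. temporal_separator G s z t S \<and> card S = k)"


section \<open>Random access programs and their running time\<close>

text \<open>
  A structured form of the unit-cost random access machine: registers and arrays hold
  unbounded natural numbers, and arrays can be addressed by computed indices. Every operator,
  literal, register access and array access costs one step, and so does every command and
  every loop test. The only arithmetic operations are addition and truncated subtraction:
  unit-cost multiplication of unbounded numbers would be an unreasonably strong primitive.
\<close>

type_synonym vname = string

record state =
  reg :: "vname \<Rightarrow> nat"
  arr :: "vname \<Rightarrow> nat \<Rightarrow> nat"

datatype aexp = N nat | R vname | Rd vname aexp | Plus aexp aexp | Minus aexp aexp

datatype bexp = Less aexp aexp | Equal aexp aexp | Neg bexp | Conj bexp bexp

datatype com =
    SKIP
  | Assign vname aexp
  | Store vname aexp aexp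
  | Seq com com
  | Cond bexp com com
  | While bexp com

fun aval :: "aexp \<Rightarrow> state \<Rightarrow> nat" where
  "aval (N k) \<sigma> = k"
| "aval (R x) \<sigma> = reg \<sigma> x"
| "aval (Rd a i) \<sigma> = arr \<sigma> a (aval i \<sigma>)"
| "aval (Plus e f) \<sigma> = aval e \<sigma> + aval f \<sigma>"
| "aval (Minus e f) \<sigma> = aval e \<sigma> - aval f \<sigma>"

fun acost :: "aexp \<Rightarrow> nat" where
  "acost (N k) = 1"
| "acost (R x) = 1"
| "acost (Rd a i) = 1 + acost i"
| "acost (Plus e f) = 1 + acost e + acost f"
| "acost (Minus e f) = 1 + acost e + acost f"

fun bval :: "bexp \<Rightarrow> state \<Rightarrow> bool" where
  "bval (Less e f) \<sigma> \<longleftrightarrow> aval e \<sigma> < aval f \<sigma>"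
| "bval (Equal e f) \<sigma> \<longleftrightarrow> aval e \<sigma> = aval f \<sigma>"
| "bval (Neg b) \<sigma> \<longleftrightarrow> \<not> bval b \<sigma>"
| "bval (Conj b c) \<sigma> \<longleftrightarrow> bval b \<sigma> \<and> bval c \<sigma>"

fun bcost :: "bexp \<Rightarrow> nat" where
  "bcost (Less e f) = 1 + acost e + acost f"
| "bcost (Equal e f) = 1 + acost e + acost f"
| "bcost (Neg b) = 1 + bcost b"
| "bcost (Conj b c) = 1 + bcost b + bcost c"

text \<open>\<open>exec P \<sigma> k \<sigma>'\<close>: started in \<open>\<sigma>\<close>, the program \<open>P\<close> halts in \<open>\<sigma>'\<close> after exactly \<open>k\<close> steps.\<close>

inductive exec :: "com \<Rightarrow> state \<Rightarrow> nat \<Rightarrow> state \<Rightarrow> bool" where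
  Skip: "exec SKIP \<sigma> 1 \<sigma>"
| Assign: "exec (Assign x e) \<sigma> (1 + acost e) (\<sigma>\<lparr>reg := (reg \<sigma>)(x := aval e \<sigma>)\<rparr>)"
| Store: "exec (Store a i e) \<sigma> (1 + acost i + acost e)
     (\<sigma>\<lparr>arr := (arr \<sigma>)(a := (arr \<sigma> a)(aval i \<sigma> := aval e \<sigma>))\<rparr>)"
| Seq: "exec P \<sigma> k \<sigma>' \<Longrightarrow> exec Q \<sigma>' l \<sigma>'' \<Longrightarrow> exec (Seq P Q) \<sigma> (1 + k + l) \<sigma>''"
| CondTrue: "bval b \<sigma> \<Longrightarrow> exec P \<sigma> k \<sigma>' \<Longrightarrow> exec (Cond b P Q) \<sigma> (1 + bcost b + k) \<sigma>'"
| CondFalse: "\<not> bval b \<sigma> \<Longrightarrow> exec Q \<sigma> k \<sigma>' \<Longrightarrow> exec (Cond b P Q) \<sigma> (1 + bcost b + k) \<sigma>'"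
| WhileFalse: "\<not> bval b \<sigma> \<Longrightarrow> exec (While b P) \<sigma> (1 + bcost b) \<sigma>"
| WhileTrue: "bval b \<sigma> \<Longrightarrow> exec P \<sigma> k \<sigma>' \<Longrightarrow> exec (While b P) \<sigma>' l \<sigma>'' \<Longrightarrow>
     exec (While b P) \<sigma> (1 + bcost b + k + l) \<sigma>''"

inductive_cases exec_SKIP_E: "exec SKIP \<sigma> k \<sigma>'"
inductive_cases exec_Assign_E: "exec (Assign x e) \<sigma> k \<sigma>'"
inductive_cases exec_Store_E: "exec (Store a i e) \<sigma> k \<sigma>'"
inductive_cases exec_Seq_E: "exec (Seq P Q) \<sigma> k \<sigma>'"
inductive_cases exec_Cond_E: "exec (Cond b P Q) \<sigma> k \<sigma>'"
inductive_cases exec_While_E: "exec (While b P) \<sigma> k \<sigma>'"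

lemma exec_deterministic:
  "exec P \<sigma> k \<sigma>' \<Longrightarrow> exec P \<sigma> l \<sigma>'' \<Longrightarrow> l = k \<and> \<sigma>'' = \<sigma>'"
proof (induction arbitrary: l \<sigma>'' rule: exec.induct)
  case Skip
  then show ?case by (rule exec_SKIP_E) simp
next
  case Assign
  then show ?case by (rule exec_Assign_E) simp
next
  case Store
  then show ?case by (rule exec_Store_E) simp
next
  case (Seq P \<sigma> k \<sigma>1 Q k' \<sigma>2)
  from Seq.prems show ?case
    by (rule exec_Seq_E) (auto dest!: Seq.IH(1) dest: Seq.IH(2))
next
  case (CondTrue b \<sigma> P k \<sigma>1 Q)
  from CondTrue.prems show ?case
    by (rule exec_Cond_E) (use CondTrue.hyps in \<open>auto dest: CondTrue.IH\<close>)
next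
  case (CondFalse b \<sigma> Q k \<sigma>1 P)
  from CondFalse.prems show ?case
    by (rule exec_Cond_E) (use CondFalse.hyps in \<open>auto dest: CondFalse.IH\<close>)
next
  case (WhileFalse b \<sigma> P)
  from WhileFalse.prems show ?case
    by (rule exec_While_E) (use WhileFalse.hyps in simp_all)
next
  case (WhileTrue b \<sigma> P k \<sigma>1 k' \<sigma>2)
  from WhileTrue.prems show ?case
  proof (rule exec_While_E)
    assume "\<not> bval b \<sigma>"
    with WhileTrue.hyps show ?thesis by simp
  qed (auto dest!: WhileTrue.IH(1) dest: WhileTrue.IH(2))
qed


section \<open>Presentation of an instance to a program\<close>

text \<open>
  A program sees the graph only through a bijective numbering \<open>num\<close> of the vertices by
  \<open>0, \<dots>, n - 1\<close> and a list \<open>es\<close> of the labelled edges, in any order. As in the edge set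
  itself, an undirected edge occurs in both orientations.
\<close>

definition vertex_numbering :: "'v temporal_graph \<Rightarrow> ('v \<Rightarrow> nat) \<Rightarrow> bool" where
  "vertex_numbering G num \<longleftrightarrow> bij_betw num (verts G) {0..<card (verts G)}"

definition edge_listing :: "'v temporal_graph \<Rightarrow> ('v \<times> 'v \<times> nat) list \<Rightarrow> bool" where
  "edge_listing G es \<longleftrightarrow> distinct es \<and> set es = edges G"

definition array_of :: "nat list \<Rightarrow> nat \<Rightarrow> nat" where
  "array_of xs i = (if i < length xs then xs ! i else 0)"

definition input_state ::
    "'v temporal_graph \<Rightarrow> 'v \<Rightarrow> 'v \<Rightarrow> nat \<Rightarrow> ('v \<Rightarrow> nat) \<Rightarrow> ('v \<times> 'v \<times> nat) list \<Rightarrow> state" where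
  "input_state G s z t num es =
     \<lparr>reg = (\<lambda>_. 0)
        (''n'' := card (verts G), ''m'' := card (edges G), ''tau'' := lifetime G,
         ''s'' := num s, ''z'' := num z, ''t'' := t),
      arr = (\<lambda>_ _. 0)
        (''src'' := array_of (map (\<lambda>e. num (edge_src e)) es),
         ''tgt'' := array_of (map (\<lambda>e. num (edge_tgt e)) es),
         ''time'' := array_of (map edge_time es))\<rparr>"

text \<open>The answer is read off from the array \<open>sep\<close>, a characteristic vector.\<close>

definition output_set :: "'v temporal_graph \<Rightarrow> ('v \<Rightarrow> nat) \<Rightarrow> state \<Rightarrow> 'v set" where
  "output_set G num \<sigma> = {v \<in> verts G. arr \<sigma> ''sep'' (num v) \<noteq> 0}"

end

theory Submission
  imports Defs
begin

text \<open>
  For each of the \<open>\<tau>\<close> time windows of length \<open>t\<close>, take a minimum cut in the time-expanded network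
  of the window, where each vertex copy \<open>(v, i)\<close> is split into an entry and an exit joined by an
  arc, and delete every vertex that has a copy on the cut. A separator \<open>S\<close> induces a cut of at most
  \<open>\<tau> * card S\<close> arcs in each network, whence the factor \<open>\<tau>\<^sup>2\<close>.

  The minimum cuts are computed with augmenting paths, without mentioning flows: as long as
  the sink can be reached from the source, all arcs of a path found by breadth-first search are
  reversed. A reversal lowers the number of arcs leaving \<open>A\<close> by exactly one, for every set \<open>A\<close> of
  nodes that contains the source but not the sink. When the sink cannot be reached any more, no
  arc leaves the set of reachable nodes, which is therefore a minimum cut of the initial
  network. The number of rounds is limited to one more than the number of nodes, because the
  minimum cut is not larger than that if there is a separator.
\<close>

section \<open>Running programs within a time bound\<close>

text \<open>A path with first label \<open>w\<close> and travelling time at most \<open>t\<close>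
  has all its labels in \<open>{w..<w + t}\<close>, so one window for each possible first label is
  enough. Inside a window the nodes of a vertex form a chain in temporal order, which models waiting
  as well as passing through. Edge arcs have the same unit weight as chain arcs and may lie on a
  minimum cut; such an arc is charged to one of its endpoints other than \<open>s\<close> and
  \<open>z\<close>, which exists because a separator excludes an edge from \<open>s\<close> to
  \<open>z\<close>.

  The two directions between cuts and separators differ in difficulty. A temporal path is followed
  arc by arc in the network, but a path of the network may return to a vertex, and temporal paths
  may not; hence the shortcut in \<open>reaches_step\<close>.

  Time: a network has \<open>NN = 2 * n * tau\<close> nodes and \<open>M = NN + m\<close> arcs, a
  round is linear in \<open>M + NN\<close>, there are at most \<open>NN + 1\<close> rounds for a
  window and \<open>tau\<close> windows. The product is of order
  \<open>(m + n * tau) * (n * tau) * tau\<close>. To stay within it, all loops, including the search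
  and the construction of the arcs, need explicit bounds on the number of iterations.\<close>

definition runs :: "com \<Rightarrow> state \<Rightarrow> nat \<Rightarrow> (state \<Rightarrow> bool) \<Rightarrow> bool" where
  "runs P \<sigma> T Q \<longleftrightarrow> (\<exists>k \<sigma>'. exec P \<sigma> k \<sigma>' \<and> k \<le> T \<and> Q \<sigma>')"

text \<open>An upper bound \<open>T\<close> in place of an exact step count lets branches and
  iterations of different lengths share one budget. As \<open>exec\<close> is deterministic, the
  existential in \<open>runs\<close> speaks about the only possible outcome.\<close>

lemma runs_mono:
  "runs P \<sigma> T Q \<Longrightarrow> T \<le> T' \<Longrightarrow> (\<And>\<sigma>'. Q \<sigma>' \<Longrightarrow> Q' \<sigma>') \<Longrightarrow> runs P \<sigma> T' Q'"
  unfolding runs_def by (meson le_trans)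

lemma runs_Seq:
  assumes "runs P \<sigma> T1 (\<lambda>\<sigma>'. runs P' \<sigma>' T2 Q)"
  shows "runs (Seq P P') \<sigma> (1 + T1 + T2) Q"
proof -
  from assms obtain k \<sigma>1 l \<sigma>2 where
    "exec P \<sigma> k \<sigma>1" "k \<le> T1" "exec P' \<sigma>1 l \<sigma>2" "l \<le> T2" "Q \<sigma>2"
    unfolding runs_def by blast
  then show ?thesis
    unfolding runs_def by (intro exI[of _ "1 + k + l"] exI[of _ \<sigma>2]) (auto intro: exec.Seq[simplified])
qed

fun wregs :: "com \<Rightarrow> vname set" where
  "wregs SKIP = {}"
| "wregs (Assign x e) = {x}"
| "wregs (Store a i e) = {}"
| "wregs (Seq P Q) = wregs P \<union> wregs Q"
| "wregs (Cond b P Q) = wregs P \<union> wregs Q"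
| "wregs (While b P) = wregs P"

fun warrs :: "com \<Rightarrow> vname set" where
  "warrs SKIP = {}"
| "warrs (Assign x e) = {}"
| "warrs (Store a i e) = {a}"
| "warrs (Seq P Q) = warrs P \<union> warrs Q"
| "warrs (Cond b P Q) = warrs P \<union> warrs Q"
| "warrs (While b P) = warrs P"

text \<open>Loop invariants only describe what a loop changes; inputs and finished tables are
  recovered from \<open>frame\<close>, which the simplifier evaluates on the program text.\<close>

definition frame :: "com \<Rightarrow> state \<Rightarrow> state \<Rightarrow> bool" where
  "frame P \<sigma> \<sigma>' \<longleftrightarrow> (\<forall>x. x \<notin> wregs P \<longrightarrow> reg \<sigma>' x = reg \<sigma> x) \<and>
     (\<forall>a. a \<notin> warrs P \<longrightarrow> arr \<sigma>' a = arr \<sigma> a)"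

lemma frame_refl: "frame P \<sigma> \<sigma>"
  by (simp add: frame_def)

lemma frame_trans: "frame P \<sigma> \<sigma>' \<Longrightarrow> frame P \<sigma>' \<sigma>'' \<Longrightarrow> frame P \<sigma> \<sigma>''"
  by (auto simp: frame_def)

lemma exec_frame: "exec P \<sigma> k \<sigma>' \<Longrightarrow> frame P \<sigma> \<sigma>'"
  by (induction rule: exec.induct) (auto simp: frame_def)

lemma runs_frame: "runs P \<sigma> T Q \<Longrightarrow> runs P \<sigma> T (\<lambda>\<sigma>'. Q \<sigma>' \<and> frame P \<sigma> \<sigma>')"
  unfolding runs_def by (meson exec_frame)

fun loopfree :: "com \<Rightarrow> bool" where
  "loopfree (Seq P Q) \<longleftrightarrow> loopfree P \<and> loopfree Q"
| "loopfree (Cond b P Q) \<longleftrightarrow> loopfree P \<and> loopfree Q"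
| "loopfree (While b P) \<longleftrightarrow> False"
| "loopfree _ \<longleftrightarrow> True"

text \<open>Both branches of a conditional are added instead of taking the maximum, as only an upper
  bound is wanted. The value for \<open>While\<close> is a dummy, guarded by
  \<open>loopfree\<close>.\<close>

fun lfcost :: "com \<Rightarrow> nat" where
  "lfcost SKIP = 1"
| "lfcost (Assign x e) = 1 + acost e"
| "lfcost (Store a i e) = 1 + acost i + acost e"
| "lfcost (Seq P Q) = 1 + lfcost P + lfcost Q"
| "lfcost (Cond b P Q) = 1 + bcost b + lfcost P + lfcost Q"
| "lfcost (While b P) = 0"

text \<open>Symbolic execution: rewriting with these equations turns the verification of a loop body
  into a statement about states, without a derivation in \<open>exec\<close>.\<close>

fun lfsem :: "com \<Rightarrow> state \<Rightarrow> state" where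
  "lfsem SKIP \<sigma> = \<sigma>"
| "lfsem (Assign x e) \<sigma> = \<sigma>\<lparr>reg := (reg \<sigma>)(x := aval e \<sigma>)\<rparr>"
| "lfsem (Store a i e) \<sigma> = \<sigma>\<lparr>arr := (arr \<sigma>)(a := (arr \<sigma> a)(aval i \<sigma> := aval e \<sigma>))\<rparr>"
| "lfsem (Seq P Q) \<sigma> = lfsem Q (lfsem P \<sigma>)"
| "lfsem (Cond b P Q) \<sigma> = (if bval b \<sigma> then lfsem P \<sigma> else lfsem Q \<sigma>)"
| "lfsem (While b P) \<sigma> = \<sigma>"

lemma exec_loopfree: "loopfree P \<Longrightarrow> \<exists>k \<le> lfcost P. exec P \<sigma> k (lfsem P \<sigma>)"
proof (induction P arbitrary: \<sigma>)
  case (Seq P Q)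
  then obtain k l where "k \<le> lfcost P" "exec P \<sigma> k (lfsem P \<sigma>)"
    "l \<le> lfcost Q" "exec Q (lfsem P \<sigma>) l (lfsem Q (lfsem P \<sigma>))"
    by (meson loopfree.simps(1))
  then show ?case
    by (intro exI[of _ "1 + k + l"]) (auto intro: exec.Seq[simplified])
next
  case (Cond b P Q)
  show ?case
  proof (cases "bval b \<sigma>")
    case True
    from Cond obtain k where "k \<le> lfcost P" "exec P \<sigma> k (lfsem P \<sigma>)" by fastforce
    with True show ?thesis
      by (intro exI[of _ "1 + bcost b + k"]) (auto intro: exec.CondTrue[simplified])
  next
    case False
    from Cond obtain k where "k \<le> lfcost Q" "exec Q \<sigma> k (lfsem Q \<sigma>)" by fastforce
    with False show ?thesis
      by (intro exI[of _ "1 + bcost b + k"]) (auto intro: exec.CondFalse[simplified])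
  qed
qed (use exec.Skip exec.Assign exec.Store in fastforce)+

lemma runs_loopfree: "loopfree P \<Longrightarrow> lfcost P \<le> T \<Longrightarrow> Q (lfsem P \<sigma>) \<Longrightarrow> runs P \<sigma> T Q"
  unfolding runs_def using exec_loopfree[of P \<sigma>] le_trans by blast

lemma runs_Cond:
  assumes "bval b \<sigma> \<Longrightarrow> runs P \<sigma> T Q" "\<not> bval b \<sigma> \<Longrightarrow> runs P' \<sigma> T Q"
  shows "runs (Cond b P P') \<sigma> (1 + bcost b + T) Q"
proof (cases "bval b \<sigma>")
  case True
  with assms(1) obtain k \<sigma>' where "exec P \<sigma> k \<sigma>'" "k \<le> T" "Q \<sigma>'" unfolding runs_def by blast
  with True show ?thesis unfolding runs_def
    by (intro exI[of _ "1 + bcost b + k"] exI[of _ \<sigma>']) (auto intro: exec.CondTrue[simplified])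
next
  case False
  with assms(2) obtain k \<sigma>' where "exec P' \<sigma> k \<sigma>'" "k \<le> T" "Q \<sigma>'" unfolding runs_def by blast
  with False show ?thesis unfolding runs_def
    by (intro exI[of _ "1 + bcost b + k"] exI[of _ \<sigma>']) (auto intro: exec.CondFalse[simplified])
qed

text \<open>At most \<open>U\<close> iterations cost at most \<open>K\<close> each, and the final
  failing test is paid by one more \<open>K\<close>; hence \<open>U + 1\<close>. The step may use
  the frame since loop entry, which keeps unchanged data out of \<open>I\<close>.\<close>

lemma runs_While:
  assumes I: "I \<sigma>0" and K: "C + 1 + bcost b \<le> K" and U: "\<phi> \<sigma>0 \<le> U"
    and step: "\<And>\<sigma>. I \<sigma> \<Longrightarrow> bval b \<sigma> \<Longrightarrow> frame P \<sigma>0 \<sigma> \<Longrightarrow>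
      runs P \<sigma> C (\<lambda>\<sigma>'. I \<sigma>' \<and> \<phi> \<sigma>' < \<phi> \<sigma>)"
  shows "runs (While b P) \<sigma>0 (K * (U + 1)) (\<lambda>\<sigma>'. I \<sigma>' \<and> \<not> bval b \<sigma>' \<and> frame P \<sigma>0 \<sigma>')"
proof -
  have "runs (While b P) \<sigma> (K * (\<phi> \<sigma> + 1)) (\<lambda>\<sigma>'. I \<sigma>' \<and> \<not> bval b \<sigma>' \<and> frame P \<sigma>0 \<sigma>')"
    if "I \<sigma>" "frame P \<sigma>0 \<sigma>" for \<sigma>
    using that
  proof (induction "\<phi> \<sigma>" arbitrary: \<sigma> rule: less_induct)
    case less
    show ?case
    proof (cases "bval b \<sigma>")
      case False
      with less.prems K show ?thesis
        unfolding runs_def by (intro exI[of _ "1 + bcost b"] exI[of _ \<sigma>]) (auto intro: exec.WhileFalse[simplified])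
    next
      case True
      from step[OF less.prems(1) True less.prems(2)] obtain k \<sigma>1 where
        k: "exec P \<sigma> k \<sigma>1" "k \<le> C" "I \<sigma>1" "\<phi> \<sigma>1 < \<phi> \<sigma>" unfolding runs_def by blast
      from k(1) less.prems(2) have "frame P \<sigma>0 \<sigma>1" by (blast intro: frame_trans exec_frame)
      with less.hyps[OF k(4) k(3)] obtain l \<sigma>2 where
        l: "exec (While b P) \<sigma>1 l \<sigma>2" "l \<le> K * (\<phi> \<sigma>1 + 1)"
          "I \<sigma>2 \<and> \<not> bval b \<sigma>2 \<and> frame P \<sigma>0 \<sigma>2" unfolding runs_def by blast
      have "K * (\<phi> \<sigma>1 + 1) \<le> K * \<phi> \<sigma>" using k(4) by (intro mult_le_mono2) simp
      with l(2) K k(2) have "1 + bcost b + k + l \<le> K * (\<phi> \<sigma> + 1)" by simp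
      with exec.WhileTrue[OF True k(1) l(1)] l(3) show ?thesis
        unfolding runs_def by blast
    qed
  qed
  from this[OF I frame_refl] show ?thesis
    by (rule runs_mono) (use U in simp_all)
qed

lemma runs_While_loopfree:
  assumes "loopfree P" "lfcost P + 1 + bcost b \<le> K" "I \<sigma>0" "\<phi> \<sigma>0 \<le> U"
    and "\<And>\<sigma>. I \<sigma> \<Longrightarrow> bval b \<sigma> \<Longrightarrow> frame P \<sigma>0 \<sigma> \<Longrightarrow> I (lfsem P \<sigma>) \<and> \<phi> (lfsem P \<sigma>) < \<phi> \<sigma>"
  shows "runs (While b P) \<sigma>0 (K * (U + 1)) (\<lambda>\<sigma>'. I \<sigma>' \<and> \<not> bval b \<sigma>' \<and> frame P \<sigma>0 \<sigma>')"
  using assms by (intro runs_While[where C = "lfcost P" and \<phi> = \<phi>]) (auto intro: runs_loopfree)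

lemma runs_Seq_loopfree:
  assumes "loopfree P" "runs P' (lfsem P \<sigma>) T Q"
  shows "runs (Seq P P') \<sigma> (1 + lfcost P + T) Q"
  using assms by (intro runs_Seq runs_loopfree[OF assms(1)]) auto

section \<open>The program\<close>

abbreviation seq_com (infixr ";;" 60) where "P ;; P' \<equiv> Seq P P'"

abbreviation incr :: "vname \<Rightarrow> com" where "incr x \<equiv> Assign x (Plus (R x) (N 1))"

text \<open>The machine can neither multiply nor divide, so \<open>v\<close>, \<open>j\<close> and
  \<open>q = v * L + j\<close> are advanced together. The base \<open>v * L\<close> is obtained as
  \<open>q - j\<close> and tabulated in \<open>bs\<close> for later address computations.\<close>

definition layout_body :: com where
  "layout_body =
     Store ''A'' (R ''q'') (R ''q'') ;;
     Cond (Conj (Neg (Equal (R ''v'') (R ''s'')))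
            (Conj (Neg (Equal (R ''v'') (R ''z''))) (Less (Plus (R ''j'') (N 1)) (R ''L''))))
       (Store ''B'' (R ''q'') (Plus (R ''q'') (N 1)))
       (Store ''B'' (R ''q'') (R ''q'')) ;;
     Store ''lab'' (R ''q'') (R ''v'') ;;
     Store ''bs'' (R ''v'') (Minus (R ''q'') (R ''j'')) ;;
     incr ''q'' ;; incr ''j'' ;;
     Cond (Equal (R ''j'') (R ''L'')) (Assign ''j'' (N 0) ;; incr ''v'') SKIP"

definition layout_init :: com where
  "layout_init = Assign ''L'' (Plus (R ''tau'') (R ''tau'')) ;;
     Assign ''v'' (N 0) ;; Assign ''j'' (N 0) ;; Assign ''q'' (N 0)"

definition layout_final :: com where
  "layout_final = Assign ''NN'' (R ''q'') ;; Assign ''M'' (Plus (R ''q'') (R ''m'')) ;;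
     Assign ''S'' (Rd ''bs'' (R ''s'')) ;; Assign ''Z'' (Rd ''bs'' (R ''z''))"

definition layout :: com where
  "layout = layout_init ;; While (Less (R ''v'') (R ''n'')) layout_body ;; layout_final"

text \<open>An edge that does not count in the window becomes a loop at node \<open>0\<close>
  instead of being skipped, so that edge \<open>e\<close> owns arc \<open>NN + e\<close> in every
  window.\<close>

definition edges_body :: com where
  "edges_body =
     Assign ''u'' (Rd ''src'' (R ''e'')) ;;
     Assign ''v'' (Rd ''tgt'' (R ''e'')) ;;
     Assign ''i'' (Rd ''time'' (R ''e'')) ;;
     Cond (Conj (Conj (Neg (Less (R ''i'') (R ''w''))) (Less (R ''i'') (Plus (R ''w'') (R ''t''))))
            (Conj (Neg (Equal (R ''v'') (R ''s''))) (Neg (Equal (R ''u'') (R ''z'')))))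
       (Cond (Equal (R ''u'') (R ''s''))
          (Store ''A'' (R ''a'') (R ''S''))
          (Store ''A'' (R ''a'')
             (Minus (Plus (Rd ''bs'' (R ''u'')) (Plus (R ''i'') (R ''i''))) (N 1))) ;;
        Cond (Equal (R ''v'') (R ''z''))
          (Store ''B'' (R ''a'') (R ''Z''))
          (Store ''B'' (R ''a'')
             (Minus (Plus (Rd ''bs'' (R ''v'')) (Plus (R ''i'') (R ''i''))) (N 2))))
       (Store ''A'' (R ''a'') (N 0) ;; Store ''B'' (R ''a'') (N 0)) ;;
     Cond (Equal (R ''v'') (R ''z''))
       (Store ''lab'' (R ''a'') (R ''u'')) (Store ''lab'' (R ''a'') (R ''v'')) ;;
     incr ''e'' ;; incr ''a''"

definition edge_arcs :: com where
  "edge_arcs = (Assign ''e'' (N 0) ;; Assign ''a'' (R ''NN'')) ;;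
     While (Less (R ''e'') (R ''m'')) edges_body"

text \<open>\<open>tl\<close> and \<open>hd\<close> are the working copy on which arcs are reversed.
  The cut is read off later from the initial arcs in \<open>A\<close> and \<open>B\<close>.\<close>

definition copy_body :: com where
  "copy_body = Store ''tl'' (R ''a'') (Rd ''A'' (R ''a'')) ;;
     Store ''hd'' (R ''a'') (Rd ''B'' (R ''a'')) ;; incr ''a''"

definition copy_arcs :: com where
  "copy_arcs = Assign ''a'' (N 0) ;; While (Less (R ''a'') (R ''M'')) copy_body"

definition clear_body :: com where
  "clear_body = Store ''mark'' (R ''q'') (N 0) ;; Store ''head'' (R ''q'') (N 0) ;; incr ''q''"

definition clear :: com where
  "clear = Assign ''q'' (N 0) ;; While (Less (R ''q'') (R ''NN'')) clear_body"

text \<open>The lists of outgoing arcs are rebuilt in each round, because a reversal moves arcs to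
  other tails. This takes time linear in the number of arcs, like the search itself.\<close>

definition link_body :: com where
  "link_body = Store ''nxt'' (R ''a'') (Rd ''head'' (Rd ''tl'' (R ''a''))) ;;
     Store ''head'' (Rd ''tl'' (R ''a'')) (Plus (R ''a'') (N 1)) ;; incr ''a''"

definition link :: com where
  "link = Assign ''a'' (N 0) ;; While (Less (R ''a'') (R ''M'')) link_body"

definition search_init :: com where
  "search_init = Store ''mark'' (R ''S'') (N 1) ;; Store ''qu'' (N 1) (R ''S'') ;;
     Assign ''h'' (N 0) ;; Assign ''k'' (N 1) ;; Assign ''a'' (N 0)"

text \<open>Taking a node from the queue and walking through its arc list are merged into one loop.
  Each iteration handles one queue entry or one arc, which gives a linear bound and keeps the body
  free of loops.\<close>

definition search_body :: com where
  "search_body =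
     Cond (Equal (R ''a'') (N 0))
       (incr ''h'' ;; Assign ''a'' (Rd ''head'' (Rd ''qu'' (R ''h''))))
       (Assign ''y'' (Rd ''hd'' (Minus (R ''a'') (N 1))) ;;
        Cond (Equal (Rd ''mark'' (R ''y'')) (N 0))
          (incr ''k'' ;; Store ''mark'' (R ''y'') (R ''k'') ;; Store ''par'' (R ''y'') (R ''a'') ;;
           Store ''qu'' (R ''k'') (R ''y''))
          SKIP ;;
        Assign ''a'' (Rd ''nxt'' (Minus (R ''a'') (N 1))))"

definition search :: com where
  "search = search_init ;;
     While (Neg (Conj (Equal (R ''a'') (N 0)) (Equal (R ''h'') (R ''k'')))) search_body"

text \<open>After the second assignment \<open>x\<close> is both the next node on the way back to
  the source and the saved tail for the swap.\<close>

definition reverse_body :: com where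
  "reverse_body = Assign ''a'' (Minus (Rd ''par'' (R ''x'')) (N 1)) ;;
     Assign ''x'' (Rd ''tl'' (R ''a'')) ;;
     Store ''tl'' (R ''a'') (Rd ''hd'' (R ''a'')) ;; Store ''hd'' (R ''a'') (R ''x'')"

definition reverse_path :: com where
  "reverse_path = Assign ''x'' (R ''Z'') ;; While (Neg (Equal (R ''x'') (R ''S''))) reverse_body"

definition augment :: com where
  "augment = clear ;; link ;; search ;;
     Cond (Equal (Rd ''mark'' (R ''Z'')) (N 0)) (Assign ''g'' (N 0))
       (reverse_path ;; Assign ''g'' (Minus (R ''g'') (N 1)))"

text \<open>\<open>g\<close> is the number of remaining rounds; an unreachable sink sets it to
  \<open>0\<close>. The counter bounds the running time even for instances that have no
  separator.\<close>

definition max_flow :: com where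
  "max_flow = Assign ''g'' (Plus (R ''NN'') (N 1)) ;; While (Less (N 0) (R ''g'')) augment"

definition collect_body :: com where
  "collect_body =
     Cond (Conj (Less (N 0) (Rd ''mark'' (Rd ''A'' (R ''a''))))
            (Equal (Rd ''mark'' (Rd ''B'' (R ''a''))) (N 0)))
       (Store ''sep'' (Rd ''lab'' (R ''a'')) (N 1)) SKIP ;;
     incr ''a''"

definition collect :: com where
  "collect = Assign ''a'' (N 0) ;; While (Less (R ''a'') (R ''M'')) collect_body"

definition window :: com where
  "window = edge_arcs ;; copy_arcs ;; max_flow ;; collect ;; incr ''w''"

definition all_windows :: com where
  "all_windows = Assign ''w'' (N 1) ;; While (Neg (Less (R ''tau'') (R ''w''))) window"

text \<open>If \<open>s\<close> and \<open>z\<close> coincide, no temporal path joins them, because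
  its vertices are distinct; the initial all-zero \<open>sep\<close> then already encodes the
  separator \<open>{}\<close>.\<close>

definition separator_program :: com where
  "separator_program = Cond (Equal (R ''s'') (R ''z'')) SKIP (layout ;; all_windows)"


section \<open>Clearing, linking and copying\<close>

lemma copy_arcs_spec:
  assumes "reg \<sigma> ''M'' = M"
  shows "runs copy_arcs \<sigma> (100 * (M + 1)) (\<lambda>\<sigma>'. frame copy_arcs \<sigma> \<sigma>' \<and>
    (\<forall>b<M. arr \<sigma>' ''tl'' b = arr \<sigma> ''A'' b \<and> arr \<sigma>' ''hd'' b = arr \<sigma> ''B'' b))"
proof -
  let ?I = "\<lambda>\<sigma>'. reg \<sigma>' ''a'' \<le> M \<and>
    (\<forall>b<reg \<sigma>' ''a''. arr \<sigma>' ''tl'' b = arr \<sigma> ''A'' b \<and> arr \<sigma>' ''hd'' b = arr \<sigma> ''B'' b)"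
  have "runs copy_arcs \<sigma> (1 + lfcost (Assign ''a'' (N 0)) + 50 * (M + 1))
    (\<lambda>\<sigma>'. ?I \<sigma>' \<and> \<not> bval (Less (R ''a'') (R ''M'')) \<sigma>' \<and>
       frame copy_body (lfsem (Assign ''a'' (N 0)) \<sigma>) \<sigma>')"
    unfolding copy_arcs_def
    by (intro runs_Seq_loopfree runs_While_loopfree[where \<phi> = "\<lambda>\<sigma>. M - reg \<sigma> ''a''"])
       (use assms in \<open>auto simp: copy_body_def frame_def less_Suc_eq\<close>)
  from runs_frame[OF this] show ?thesis
    by (rule runs_mono) (use assms in \<open>auto simp: frame_def copy_body_def\<close>)
qed

lemma clear_spec:
  assumes "reg \<sigma> ''NN'' = NN"
  shows "runs clear \<sigma> (100 * (NN + 1)) (\<lambda>\<sigma>'. frame clear \<sigma> \<sigma>' \<and>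
    (\<forall>x<NN. arr \<sigma>' ''mark'' x = 0 \<and> arr \<sigma>' ''head'' x = 0))"
proof -
  let ?I = "\<lambda>\<sigma>'. reg \<sigma>' ''q'' \<le> NN \<and>
    (\<forall>x<reg \<sigma>' ''q''. arr \<sigma>' ''mark'' x = 0 \<and> arr \<sigma>' ''head'' x = 0)"
  have "runs clear \<sigma> (1 + lfcost (Assign ''q'' (N 0)) + 50 * (NN + 1))
    (\<lambda>\<sigma>'. ?I \<sigma>' \<and> \<not> bval (Less (R ''q'') (R ''NN'')) \<sigma>' \<and>
       frame clear_body (lfsem (Assign ''q'' (N 0)) \<sigma>) \<sigma>')"
    unfolding clear_def
    by (intro runs_Seq_loopfree runs_While_loopfree[where \<phi> = "\<lambda>\<sigma>. NN - reg \<sigma> ''q''"])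
       (use assms in \<open>auto simp: clear_body_def frame_def less_Suc_eq\<close>)
  from runs_frame[OF this] show ?thesis
    by (rule runs_mono) (use assms in \<open>auto simp: frame_def clear_body_def\<close>)
qed

text \<open>One plus the last arc with tail \<open>x\<close> among the first \<open>i\<close> ones, or \<open>0\<close>: the value of a
  list pointer, as the arcs leaving \<open>x\<close> are linked in decreasing order.\<close>

fun last_arc :: "(nat \<Rightarrow> nat) \<Rightarrow> nat \<Rightarrow> nat \<Rightarrow> nat" where
  "last_arc ta x 0 = 0"
| "last_arc ta x (Suc i) = (if ta i = x then Suc i else last_arc ta x i)"

lemma last_arc_le: "last_arc ta x i \<le> i"
  by (induction i) auto

lemma last_arc_greater: "b < i \<Longrightarrow> ta b = x \<Longrightarrow> b < last_arc ta x i"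
  by (induction i) (auto simp: less_Suc_eq)

lemma tail_last_arc: "0 < last_arc ta x i \<Longrightarrow> ta (last_arc ta x i - 1) = x"
  by (induction i) (auto split: if_splits)

text \<open>When arc \<open>b\<close> is linked, \<open>head\<close> still refers to the arcs below
  \<open>b\<close>. So the pointer saved in \<open>nxt\<close> is \<open>last_arc\<close> with bound
  \<open>b\<close>, while \<open>head\<close> ends up with bound \<open>M\<close>.\<close>

lemma link_spec:
  assumes "reg \<sigma> ''M'' = M" "\<forall>b<M. arr \<sigma> ''tl'' b < NN" "\<forall>x<NN. arr \<sigma> ''head'' x = 0"
  defines "ta \<equiv> arr \<sigma> ''tl''"
  shows "runs link \<sigma> (100 * (M + 1)) (\<lambda>\<sigma>'. frame link \<sigma> \<sigma>' \<and>
    (\<forall>x<NN. arr \<sigma>' ''head'' x = last_arc ta x M) \<and>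
    (\<forall>b<M. arr \<sigma>' ''nxt'' b = last_arc ta (ta b) b))"
proof -
  let ?I = "\<lambda>\<sigma>'. reg \<sigma>' ''a'' \<le> M \<and>
    (\<forall>x<NN. arr \<sigma>' ''head'' x = last_arc ta x (reg \<sigma>' ''a'')) \<and>
    (\<forall>b<reg \<sigma>' ''a''. arr \<sigma>' ''nxt'' b = last_arc ta (ta b) b)"
  have "runs link \<sigma> (1 + lfcost (Assign ''a'' (N 0)) + 50 * (M + 1))
    (\<lambda>\<sigma>'. ?I \<sigma>' \<and> \<not> bval (Less (R ''a'') (R ''M'')) \<sigma>' \<and>
       frame link_body (lfsem (Assign ''a'' (N 0)) \<sigma>) \<sigma>')"
    unfolding link_def
    by (intro runs_Seq_loopfree runs_While_loopfree[where \<phi> = "\<lambda>\<sigma>. M - reg \<sigma> ''a''"])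
       (use assms in \<open>auto simp: link_body_def frame_def less_Suc_eq\<close>)
  from runs_frame[OF this] show ?thesis
    by (rule runs_mono) (use assms in \<open>auto simp: frame_def link_body_def\<close>)
qed

section \<open>Breadth-first search\<close>

text \<open>\<open>mark y\<close> is the position of \<open>y\<close> in the queue, which starts at position \<open>1\<close>. The nodes up
  to position \<open>h\<close> have been scanned, except for the arcs below \<open>a\<close> leaving the one at \<open>h\<close>.\<close>

locale arc_list =
  fixes NN M :: nat and ta he :: "nat \<Rightarrow> nat" and S :: nat
  assumes tail_less: "b < M \<Longrightarrow> ta b < NN"
    and head_less: "b < M \<Longrightarrow> he b < NN"
    and source_less: "S < NN"
begin

text \<open>The last clause makes marks decrease strictly along parent arcs; this is what ends the
  walk back from the sink in \<open>reverse_path_spec\<close>.\<close>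

definition search_inv ::
    "(nat \<Rightarrow> nat) \<Rightarrow> (nat \<Rightarrow> nat) \<Rightarrow> (nat \<Rightarrow> nat) \<Rightarrow> nat \<Rightarrow> nat \<Rightarrow> nat \<Rightarrow> bool" where
  "search_inv mark qu par h k a \<longleftrightarrow>
     h \<le> k \<and> 1 \<le> k \<and>
     (\<forall>y<NN. mark y \<le> k \<and> (mark y \<noteq> 0 \<longrightarrow> qu (mark y) = y)) \<and>
     (\<forall>i. 1 \<le> i \<and> i \<le> k \<longrightarrow> qu i < NN \<and> mark (qu i) = i) \<and>
     qu 1 = S \<and>
     (\<forall>b<M. 1 \<le> mark (ta b) \<and> mark (ta b) \<le> h \<longrightarrow>
        mark (he b) \<noteq> 0 \<or> mark (ta b) = h \<and> b < a) \<and>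
     (a \<noteq> 0 \<longrightarrow> a \<le> M \<and> 1 \<le> h \<and> ta (a - 1) = qu h) \<and>
     (\<forall>y<NN. 1 < mark y \<longrightarrow>
        (\<exists>b<M. par y = Suc b \<and> he b = y \<and> 1 \<le> mark (ta b) \<and> mark (ta b) < mark y))"

definition pending :: "(nat \<Rightarrow> nat) \<Rightarrow> nat \<Rightarrow> nat \<Rightarrow> nat set" where
  "pending mark h a =
     {b. b < M \<and> (mark (ta b) = 0 \<or> h < mark (ta b) \<or> mark (ta b) = h \<and> b < a)}"

text \<open>Scanning removes an arc from \<open>pending\<close>, and taking a node from the queue
  raises \<open>h\<close>. Initially the sum is at most \<open>M + NN\<close>, which bounds the
  iterations of the search.\<close>

definition search_todo :: "(nat \<Rightarrow> nat) \<Rightarrow> nat \<Rightarrow> nat \<Rightarrow> nat" where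
  "search_todo mark h a = card (pending mark h a) + (NN - h)"

lemma finite_pending: "finite (pending mark h a)"
  by (simp add: pending_def)

text \<open>\<open>qu\<close> is injective on \<open>{1..k}\<close> with inverse
  \<open>mark\<close>. The bound ensures that the truncated difference \<open>NN - h\<close> really
  drops when a node is taken from the queue.\<close>

lemma search_inv_queue_le:
  assumes "search_inv mark qu par h k a"
  shows "k \<le> NN"
proof -
  have "inj_on qu {1..k}" "qu ` {1..k} \<subseteq> {..<NN}"
    using assms unfolding search_inv_def by (auto intro!: inj_on_inverseI[where g = mark])
  from card_inj_on_le[OF this] show ?thesis by simp
qed

text \<open>\<open>last_arc\<close> with bound \<open>M\<close> lies above every arc leaving the new
  node, so all of them fall under the exception \<open>b < a\<close> of the invariant.\<close>

lemma search_inv_pop: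
  assumes inv: "search_inv mark qu par h k 0" and "h \<noteq> k"
  defines "a \<equiv> last_arc ta (qu (Suc h)) M"
  shows "search_inv mark qu par (Suc h) k a \<and> search_todo mark (Suc h) a < search_todo mark h 0"
proof
  have h: "Suc h \<le> k" using assms unfolding search_inv_def by auto
  show "search_inv mark qu par (Suc h) k a"
  proof -
    have "mark (he b) \<noteq> 0 \<or> mark (ta b) = Suc h \<and> b < a"
      if "b < M" "1 \<le> mark (ta b)" "mark (ta b) \<le> Suc h" for b
    proof (cases "mark (ta b) \<le> h")
      case True
      then show ?thesis using that inv unfolding search_inv_def by auto
    next
      case False
      with that have "mark (ta b) = Suc h" by simp
      moreover from this that inv have "ta b = qu (Suc h)"
        unfolding search_inv_def by (metis nat.distinct(1) tail_less)
      ultimately show ?thesis using last_arc_greater[OF that(1), of ta "ta b"] unfolding a_def by simp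
    qed
    moreover have "a \<le> M" "a \<noteq> 0 \<Longrightarrow> ta (a - 1) = qu (Suc h)"
      unfolding a_def using tail_last_arc[of ta "qu (Suc h)" M] by (auto simp: last_arc_le)
    ultimately show ?thesis using inv h unfolding search_inv_def by auto
  qed
  have "pending mark (Suc h) a \<subseteq> pending mark h 0" unfolding pending_def by auto
  from card_mono[OF finite_pending this] h search_inv_queue_le[OF inv]
  show "search_todo mark (Suc h) a < search_todo mark h 0" unfolding search_todo_def by linarith
qed

text \<open>The head of arc \<open>a - 1\<close> is marked afterwards in either case, which settles
  this arc. Arcs from \<open>a'\<close> up to \<open>a - 2\<close> have other tails, by the
  maximality in \<open>last_arc_greater\<close>.\<close>

lemma search_inv_scan:
  assumes inv: "search_inv mark qu par h k a" and a: "a \<noteq> 0"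
  defines "a' \<equiv> last_arc ta (ta (a - 1)) (a - 1)" and "y \<equiv> he (a - 1)"
  defines "new \<equiv> mark y = 0"
  defines "mark' \<equiv> if new then mark(y := Suc k) else mark"
    and "qu' \<equiv> if new then qu(Suc k := y) else qu"
    and "par' \<equiv> if new then par(y := a) else par"
    and "k' \<equiv> if new then Suc k else k"
  shows "search_inv mark' qu' par' h k' a' \<and> search_todo mark' h a' < search_todo mark h a"
proof
  have aM: "a - 1 < M" and h: "1 \<le> h" "h \<le> k" and ta: "ta (a - 1) = qu h"
    using inv a unfolding search_inv_def by auto
  have mh: "mark (ta (a - 1)) = h" using inv h ta unfolding search_inv_def by auto
  have y: "y < NN" using aM head_less unfolding y_def by simp
  have a': "a' < a" using a last_arc_le[of ta "ta (a - 1)" "a - 1"] unfolding a'_def by linarith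
  have mark'_y: "mark' y \<noteq> 0" unfolding mark'_def new_def by auto
  have mark'_cases: "mark' x = mark x \<or> mark x = 0 \<and> mark' x = Suc k \<and> x = y" for x
    unfolding mark'_def new_def by auto
  have scanned: "mark' (he b) \<noteq> 0 \<or> mark' (ta b) = h \<and> b < a'"
    if b: "b < M" "1 \<le> mark' (ta b)" "mark' (ta b) \<le> h" for b
  proof -
    have m: "mark' (ta b) = mark (ta b)" using mark'_cases[of "ta b"] h b by auto
    from inv b m have "mark (he b) \<noteq> 0 \<or> mark (ta b) = h \<and> b < a"
      unfolding search_inv_def by auto
    then show ?thesis
    proof
      assume "mark (he b) \<noteq> 0"
      then show ?thesis using mark'_cases[of "he b"] by auto
    next
      assume *: "mark (ta b) = h \<and> b < a"
      show ?thesis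
      proof (cases "b = a - 1")
        case True
        then show ?thesis using mark'_y unfolding y_def by simp
      next
        case False
        with * have "b < a - 1" by linarith
        moreover have "ta b = ta (a - 1)"
          using inv b(1) * h ta unfolding search_inv_def
          by (metis One_nat_def Suc_le_eq not_gr_zero tail_less)
        ultimately have "b < a'" unfolding a'_def by (rule last_arc_greater)
        with * m show ?thesis by simp
      qed
    qed
  qed
  have next_arc: "a' \<noteq> 0 \<Longrightarrow> a' \<le> M \<and> 1 \<le> h \<and> ta (a' - 1) = qu h"
    using a' aM h ta tail_last_arc[of ta "ta (a - 1)" "a - 1"] unfolding a'_def by auto
  show "search_inv mark' qu' par' h k' a'"
  proof (cases new)
    case False
    then have eqs: "mark' = mark" "qu' = qu" "par' = par" "k' = k"
      unfolding mark'_def qu'_def par'_def k'_def by simp_all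
    show ?thesis
      using inv scanned next_arc unfolding eqs search_inv_def by simp
  next
    case True
    then have eqs: "mark' = mark(y := Suc k)" "qu' = qu(Suc k := y)" "par' = par(y := a)"
      "k' = Suc k" and y0: "mark y = 0"
      unfolding mark'_def qu'_def par'_def k'_def new_def by simp_all
    have queue: "qu' i < NN \<and> mark' (qu' i) = i" if "1 \<le> i" "i \<le> Suc k" for i
      using inv that y y0 unfolding search_inv_def eqs by (cases "i = Suc k") auto
    have pos: "mark' x \<le> Suc k \<and> (mark' x \<noteq> 0 \<longrightarrow> qu' (mark' x) = x)" if "x < NN" for x
    proof -
      have "mark x \<le> k" "mark x \<noteq> 0 \<longrightarrow> qu (mark x) = x" using inv that unfolding search_inv_def by auto
      then show ?thesis unfolding eqs by auto
    qed
    have parent: "\<exists>b<M. par' x = Suc b \<and> he b = x \<and> 1 \<le> mark' (ta b) \<and> mark' (ta b) < mark' x"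
      if x: "x < NN" "1 < mark' x" for x
    proof (cases "x = y")
      case True
      have "ta (a - 1) \<noteq> y" using mh h y0 by auto
      with True aM a mh h show ?thesis
        by (intro exI[of _ "a - 1"]) (auto simp: eqs y_def)
    next
      case False
      then have "1 < mark x" using x unfolding eqs by simp
      with inv x obtain b where "b < M" "par x = Suc b" "he b = x" "1 \<le> mark (ta b)" "mark (ta b) < mark x"
        unfolding search_inv_def by auto
      with False y0 show ?thesis by (intro exI[of _ b]) (auto simp: eqs)
    qed
    have "h \<le> k'" "1 \<le> k'" "qu' 1 = S" using inv h unfolding eqs search_inv_def by auto
    with queue pos parent scanned next_arc show ?thesis
      unfolding search_inv_def eqs using h eqs(2) by auto
  qed
  have "pending mark' h a' \<subseteq> pending mark h a - {a - 1}"
  proof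
    fix b assume b: "b \<in> pending mark' h a'"
    have "b \<noteq> a - 1"
    proof
      assume "b = a - 1"
      then have "mark' (ta b) = h" using mark'_cases[of "ta b"] mh h by auto
      with b \<open>b = a - 1\<close> a' h show False unfolding pending_def by auto
    qed
    with b a' h show "b \<in> pending mark h a - {a - 1}"
      using mark'_cases[of "ta b"] unfolding pending_def by auto
  qed
  moreover have "a - 1 \<in> pending mark h a" using aM mh a unfolding pending_def by auto
  ultimately have "card (pending mark' h a') < card (pending mark h a)"
    by (metis Diff_iff finite_pending psubsetI psubset_card_mono subset_iff singletonI)
  then show "search_todo mark' h a' < search_todo mark h a" unfolding search_todo_def by simp
qed

text \<open>On exit \<open>a = 0\<close> and \<open>h = k\<close>. Then the exception
  \<open>b < a\<close> is void and every marked node has been scanned, so the marked nodes are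
  closed under arcs. As only the source has mark \<open>1\<close>, every other marked node has a
  parent.\<close>

lemma search_spec:
  assumes regs: "reg \<sigma> ''S'' = S"
    and arrs: "arr \<sigma> ''tl'' = ta" "arr \<sigma> ''hd'' = he"
    and mark: "\<forall>x<NN. arr \<sigma> ''mark'' x = 0"
    and head: "\<forall>x<NN. arr \<sigma> ''head'' x = last_arc ta x M"
    and nxt: "\<forall>b<M. arr \<sigma> ''nxt'' b = last_arc ta (ta b) b"
  shows "runs search \<sigma> (200 * (M + NN + 1)) (\<lambda>\<sigma>'. frame search \<sigma> \<sigma>' \<and>
    (\<forall>x<NN. arr \<sigma>' ''mark'' x \<le> NN \<and> (arr \<sigma>' ''mark'' x = 1 \<longleftrightarrow> x = S)) \<and>
    (\<forall>b<M. arr \<sigma>' ''mark'' (ta b) \<noteq> 0 \<longrightarrow> arr \<sigma>' ''mark'' (he b) \<noteq> 0) \<and>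
    (\<forall>y<NN. 1 < arr \<sigma>' ''mark'' y \<longrightarrow>
      (\<exists>b<M. arr \<sigma>' ''par'' y = Suc b \<and> he b = y \<and>
        1 \<le> arr \<sigma>' ''mark'' (ta b) \<and> arr \<sigma>' ''mark'' (ta b) < arr \<sigma>' ''mark'' y)))"
proof -
  let ?I = "\<lambda>\<sigma>'. search_inv (arr \<sigma>' ''mark'') (arr \<sigma>' ''qu'') (arr \<sigma>' ''par'')
    (reg \<sigma>' ''h'') (reg \<sigma>' ''k'') (reg \<sigma>' ''a'')"
  let ?phi = "\<lambda>\<sigma>'. search_todo (arr \<sigma>' ''mark'') (reg \<sigma>' ''h'') (reg \<sigma>' ''a'')"
  have init: "?I (lfsem search_init \<sigma>)"
    using mark source_less tail_less head_less regs unfolding search_init_def search_inv_def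
    by (auto split: if_splits)
  have todo: "?phi (lfsem search_init \<sigma>) \<le> M + NN"
  proof -
    have "pending mark h a \<subseteq> {..<M}" for mark h a unfolding pending_def by auto
    from card_mono[OF _ this] show ?thesis unfolding search_todo_def by (simp add: add_le_mono)
  qed
  have step: "?I (lfsem search_body \<sigma>1) \<and> ?phi (lfsem search_body \<sigma>1) < ?phi \<sigma>1"
    if I: "?I \<sigma>1" and b: "bval (Neg (Conj (Equal (R ''a'') (N 0)) (Equal (R ''h'') (R ''k'')))) \<sigma>1"
      and fr: "frame search_body (lfsem search_init \<sigma>) \<sigma>1" for \<sigma>1
  proof (cases "reg \<sigma>1 ''a'' = 0")
    case True
    with b have hk: "reg \<sigma>1 ''h'' \<noteq> reg \<sigma>1 ''k''" by simp
    with I True have "arr \<sigma>1 ''qu'' (Suc (reg \<sigma>1 ''h'')) < NN" unfolding search_inv_def by auto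
    with head fr have "arr \<sigma>1 ''head'' (arr \<sigma>1 ''qu'' (Suc (reg \<sigma>1 ''h''))) =
        last_arc ta (arr \<sigma>1 ''qu'' (Suc (reg \<sigma>1 ''h''))) M"
      by (simp add: frame_def search_body_def search_init_def)
    with search_inv_pop[OF I[unfolded True] hk] True show ?thesis
      by (simp add: search_body_def)
  next
    case False
    with I have "reg \<sigma>1 ''a'' - 1 < M" unfolding search_inv_def by auto
    with nxt fr have "arr \<sigma>1 ''nxt'' (reg \<sigma>1 ''a'' - 1) =
        last_arc ta (ta (reg \<sigma>1 ''a'' - 1)) (reg \<sigma>1 ''a'' - 1)"
      by (simp add: frame_def search_body_def search_init_def)
    moreover have "arr \<sigma>1 ''hd'' = he"
      using arrs fr by (simp add: frame_def search_body_def search_init_def)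
    ultimately show ?thesis
      using search_inv_scan[OF I False] False by (auto simp: search_body_def split: if_splits)
  qed
  have "runs search \<sigma> (1 + lfcost search_init + 100 * (M + NN + 1))
    (\<lambda>\<sigma>'. ?I \<sigma>' \<and> \<not> bval (Neg (Conj (Equal (R ''a'') (N 0)) (Equal (R ''h'') (R ''k'')))) \<sigma>' \<and>
       frame search_body (lfsem search_init \<sigma>) \<sigma>')"
    unfolding search_def
    by (intro runs_Seq_loopfree runs_While_loopfree[where \<phi> = ?phi] init todo step)
       (simp_all add: search_body_def search_init_def)
  from runs_frame[OF this] show ?thesis
  proof (rule runs_mono)
    fix \<sigma>' assume *: "(?I \<sigma>' \<and>
      \<not> bval (Neg (Conj (Equal (R ''a'') (N 0)) (Equal (R ''h'') (R ''k'')))) \<sigma>' \<and>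
       frame search_body (lfsem search_init \<sigma>) \<sigma>') \<and> frame search \<sigma> \<sigma>'"
    let ?mark = "arr \<sigma>' ''mark''" and ?qu = "arr \<sigma>' ''qu''" and ?k = "reg \<sigma>' ''k''"
    from * have "reg \<sigma>' ''h'' = ?k" "reg \<sigma>' ''a'' = 0" by simp_all
    moreover from * have "?I \<sigma>'" by blast
    ultimately have inv: "search_inv ?mark ?qu (arr \<sigma>' ''par'') ?k ?k 0" by metis
    have a: "?mark x \<le> NN \<and> (?mark x = 1 \<longleftrightarrow> x = S)" if "x < NN" for x
      proof -
      have "?mark x \<le> ?k" "?mark x \<noteq> 0 \<Longrightarrow> ?qu (?mark x) = x" "?qu 1 = S" "1 \<le> ?k"
        using inv that unfolding search_inv_def by simp_all
      note q = this
      from inv have "\<forall>i. 1 \<le> i \<and> i \<le> ?k \<longrightarrow> ?qu i < NN \<and> ?mark (?qu i) = i"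
        unfolding search_inv_def by (elim conjE)
      with q(4) have "?mark (?qu 1) = 1" by simp
      with q(3) have "?mark S = 1" by simp
      moreover have "?mark x \<le> NN" using q(1) search_inv_queue_le[OF inv] by (rule le_trans)
      moreover have "x = S" if "?mark x = 1" using q(2,3) that by simp
      ultimately show ?thesis by blast
    qed
    have b: "?mark (he b) \<noteq> 0" if "b < M" "?mark (ta b) \<noteq> 0" for b
    proof -
      have "1 \<le> ?mark (ta b)" "?mark (ta b) \<le> ?k"
        using inv that tail_less[OF that(1)] unfolding search_inv_def by auto
      with inv that(1) show ?thesis unfolding search_inv_def by blast
    qed
    from * a b inv show "frame search \<sigma> \<sigma>' \<and>
    (\<forall>x<NN. arr \<sigma>' ''mark'' x \<le> NN \<and> (arr \<sigma>' ''mark'' x = 1 \<longleftrightarrow> x = S)) \<and>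
    (\<forall>b<M. arr \<sigma>' ''mark'' (ta b) \<noteq> 0 \<longrightarrow> arr \<sigma>' ''mark'' (he b) \<noteq> 0) \<and>
    (\<forall>y<NN. 1 < arr \<sigma>' ''mark'' y \<longrightarrow>
      (\<exists>b<M. arr \<sigma>' ''par'' y = Suc b \<and> he b = y \<and>
        1 \<le> arr \<sigma>' ''mark'' (ta b) \<and> arr \<sigma>' ''mark'' (ta b) < arr \<sigma>' ''mark'' y))"
      unfolding search_inv_def by blast
  qed (simp add: search_init_def)
qed

end

section \<open>Cuts and path reversal\<close>

definition cut_arcs :: "nat \<Rightarrow> (nat \<Rightarrow> nat) \<Rightarrow> (nat \<Rightarrow> nat) \<Rightarrow> nat set \<Rightarrow> nat set" where
  "cut_arcs M ta he A = {b. b < M \<and> ta b \<in> A \<and> he b \<notin> A}"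

lemma finite_cut_arcs: "finite (cut_arcs M ta he A)"
  by (simp add: cut_arcs_def)

lemma cut_arcs_cong:
  "(\<And>b. b < M \<Longrightarrow> ta b = ta' b \<and> he b = he' b) \<Longrightarrow> cut_arcs M ta he A = cut_arcs M ta' he' A"
  by (auto simp: cut_arcs_def)

text \<open>Swapping an arc changes the count by the difference of two membership indicators. Along
  a path these differences telescope, and only the two ends of the path remain.\<close>

lemma card_cut_arcs_swap:
  assumes "a < M"
  shows "card (cut_arcs M (ta(a := he a)) (he(a := ta a)) A) + of_bool (ta a \<in> A) =
    card (cut_arcs M ta he A) + of_bool (he a \<in> A)" (is "card ?new + _ = card ?old + _")
proof -
  consider "(ta a \<in> A) = (he a \<in> A)" | "ta a \<in> A" "he a \<notin> A" | "ta a \<notin> A" "he a \<in> A" by blast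
  then show ?thesis
  proof cases
    case 1
    then have "?new = ?old" by (auto simp: cut_arcs_def)
    with 1 show ?thesis by simp
  next
    case 2
    then have "?old = insert a ?new" "a \<notin> ?new" using assms by (auto simp: cut_arcs_def)
    with 2 show ?thesis by (simp add: finite_cut_arcs)
  next
    case 3
    then have "?new = insert a ?old" "a \<notin> ?old" using assms by (auto simp: cut_arcs_def)
    with 3 show ?thesis by (simp add: finite_cut_arcs)
  qed
qed

definition arcs_less :: "nat \<Rightarrow> nat \<Rightarrow> state \<Rightarrow> bool" where
  "arcs_less NN M \<sigma> \<longleftrightarrow> (\<forall>b<M. arr \<sigma> ''tl'' b < NN \<and> arr \<sigma> ''hd'' b < NN)"

context arc_list
begin

text \<open>The telescoped change is the difference of the indicators of \<open>Z\<close> and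
  \<open>S\<close>, which is one when \<open>A\<close> separates them. The marks decrease along the
  walk and are at most \<open>NN\<close>, which bounds its length.\<close>

lemma reverse_path_spec:
  assumes regs: "reg \<sigma> ''S'' = S" "reg \<sigma> ''Z'' = Z" and Z: "Z < NN"
    and arrs: "arr \<sigma> ''tl'' = ta" "arr \<sigma> ''hd'' = he" "arr \<sigma> ''mark'' = mark" "arr \<sigma> ''par'' = par"
    and mark: "\<forall>x<NN. mark x \<le> NN \<and> (mark x = 1 \<longleftrightarrow> x = S)" "mark Z \<noteq> 0"
    and par: "\<forall>y<NN. 1 < mark y \<longrightarrow>
      (\<exists>b<M. par y = Suc b \<and> he b = y \<and> 1 \<le> mark (ta b) \<and> mark (ta b) < mark y)"
  shows "runs reverse_path \<sigma> (200 * (NN + 1)) (\<lambda>\<sigma>'. arcs_less NN M \<sigma>' \<and>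
    (\<forall>A. S \<in> A \<and> Z \<notin> A \<longrightarrow>
      card (cut_arcs M (arr \<sigma>' ''tl'') (arr \<sigma>' ''hd'') A) + 1 = card (cut_arcs M ta he A)))"
proof -
  let ?init = "Assign ''x'' (R ''Z'')" and ?b = "Neg (Equal (R ''x'') (R ''S''))"
  \<comment> \<open>The clause on \<open>par\<close> says that the parent arcs still ahead are
    untouched; the last clause is \<open>card_cut_arcs_swap\<close> summed over the part of the path
    from \<open>x\<close> to \<open>Z\<close>.\<close>
  let ?I = "\<lambda>\<sigma>'. let x = reg \<sigma>' ''x''; ta' = arr \<sigma>' ''tl''; he' = arr \<sigma>' ''hd'' in
    x < NN \<and> 1 \<le> mark x \<and> arcs_less NN M \<sigma>' \<and>
    (\<forall>y<NN. 1 < mark y \<and> mark y \<le> mark x \<longrightarrow>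
       ta' (par y - 1) = ta (par y - 1) \<and> he' (par y - 1) = y) \<and>
    (\<forall>A. card (cut_arcs M ta' he' A) + of_bool (x \<in> A) =
       card (cut_arcs M ta he A) + of_bool (Z \<in> A))"
  let ?phi = "\<lambda>\<sigma>'. mark (reg \<sigma>' ''x'')"
  have init: "?I (lfsem ?init \<sigma>)"
    using regs Z arrs mark(2) tail_less head_less par by (fastforce simp: arcs_less_def)
  have step: "?I (lfsem reverse_body \<sigma>1) \<and> ?phi (lfsem reverse_body \<sigma>1) < ?phi \<sigma>1"
    if I: "?I \<sigma>1" and b: "bval ?b \<sigma>1" and fr: "frame reverse_body (lfsem ?init \<sigma>) \<sigma>1" for \<sigma>1
  proof -
    define x ta' he' where "x = reg \<sigma>1 ''x''" and "ta' = arr \<sigma>1 ''tl''" and "he' = arr \<sigma>1 ''hd''"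
    note defs = this
    have "reg \<sigma>1 ''S'' = S" and par1: "arr \<sigma>1 ''par'' = par"
      using fr regs arrs by (simp_all add: frame_def reverse_body_def)
    with b have "x \<noteq> S" by (simp add: defs)
    have x: "x < NN" "1 \<le> mark x" and less: "\<And>b. b < M \<Longrightarrow> ta' b < NN \<and> he' b < NN"
      and keep: "\<And>y. y < NN \<Longrightarrow> 1 < mark y \<Longrightarrow> mark y \<le> mark x \<Longrightarrow>
        ta' (par y - 1) = ta (par y - 1) \<and> he' (par y - 1) = y"
      and cut: "\<And>A. card (cut_arcs M ta' he' A) + of_bool (x \<in> A) =
        card (cut_arcs M ta he A) + of_bool (Z \<in> A)"
      using I unfolding Let_def arcs_less_def defs by simp_all
    have "1 < mark x" using mark(1) x \<open>x \<noteq> S\<close> by (metis le_neq_implies_less)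
    with par x obtain c where c: "c < M" "par x = Suc c" "he c = x" "1 \<le> mark (ta c)" "mark (ta c) < mark x"
      by blast
    with keep[OF x(1) \<open>1 < mark x\<close>] have tc: "ta' c = ta c" "he' c = x" by simp_all
    let ?s = "lfsem reverse_body \<sigma>1"
    have new: "reg ?s ''x'' = ta' c" "arr ?s ''tl'' = ta'(c := he' c)" "arr ?s ''hd'' = he'(c := ta' c)"
      using par1 c(2) by (simp_all add: reverse_body_def defs)
    have "card (cut_arcs M (ta'(c := he' c)) (he'(c := ta' c)) A) + of_bool (ta' c \<in> A) =
        card (cut_arcs M ta he A) + of_bool (Z \<in> A)" for A
      using card_cut_arcs_swap[OF c(1), of ta' he' A] cut[of A] by (simp only: tc(2))
    moreover have "arcs_less NN M ?s" unfolding arcs_less_def new using less c(1) by auto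
    moreover have "(ta'(c := he' c)) (par y - 1) = ta (par y - 1) \<and> (he'(c := ta' c)) (par y - 1) = y"
      if y: "y < NN" "1 < mark y" "mark y \<le> mark (ta' c)" for y
    proof -
      from y c tc have "mark y < mark x" by simp
      moreover from par y obtain d where "par y = Suc d" "he d = y" by blast
      \<comment> \<open>Both are parent arcs of the initial network, and their heads
        \<open>y\<close> and \<open>x\<close> have different marks.\<close>
      ultimately have "par y - 1 \<noteq> c" using c by auto
      with keep[of y] y \<open>mark y < mark x\<close> show ?thesis by simp
    qed
    moreover have "ta' c < NN" "1 \<le> mark (ta' c)" "mark (ta' c) < mark (reg \<sigma>1 ''x'')"
      using less[OF c(1)] c tc by (simp_all add: defs)
    ultimately show ?thesis
      unfolding Let_def new by (intro conjI allI impI) blast+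
  qed
  have "runs reverse_path \<sigma> (1 + lfcost ?init + 100 * (NN + 1))
    (\<lambda>\<sigma>'. ?I \<sigma>' \<and> \<not> bval ?b \<sigma>' \<and> frame reverse_body (lfsem ?init \<sigma>) \<sigma>')"
    unfolding reverse_path_def
    by (intro runs_Seq_loopfree runs_While_loopfree[where \<phi> = ?phi] init step)
       (use mark Z regs in \<open>simp_all add: reverse_body_def\<close>)
  then show ?thesis
  proof (rule runs_mono)
    fix \<sigma>' assume *: "?I \<sigma>' \<and> \<not> bval ?b \<sigma>' \<and> frame reverse_body (lfsem ?init \<sigma>) \<sigma>'"
    then have xS: "reg \<sigma>' ''x'' = S" using regs by (auto simp: frame_def reverse_body_def)
    from * have less: "arcs_less NN M \<sigma>'"
      and "\<forall>A. card (cut_arcs M (arr \<sigma>' ''tl'') (arr \<sigma>' ''hd'') A) + of_bool (reg \<sigma>' ''x'' \<in> A) =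
        card (cut_arcs M ta he A) + of_bool (Z \<in> A)" unfolding Let_def by blast+
    note cut = this(2)[unfolded xS, rule_format]
    have "card (cut_arcs M (arr \<sigma>' ''tl'') (arr \<sigma>' ''hd'') A) + 1 = card (cut_arcs M ta he A)"
      if "S \<in> A" "Z \<notin> A" for A
      using cut[of A] that by simp
    with less show "arcs_less NN M \<sigma>' \<and> (\<forall>A. S \<in> A \<and> Z \<notin> A \<longrightarrow>
      card (cut_arcs M (arr \<sigma>' ''tl'') (arr \<sigma>' ''hd'') A) + 1 = card (cut_arcs M ta he A))"
      by blast
  qed simp
qed

end

section \<open>Augmentation rounds until a minimum cut is found\<close>

definition closed_marks :: "nat \<Rightarrow> nat \<Rightarrow> nat \<Rightarrow> state \<Rightarrow> bool" where
  "closed_marks M S Z \<sigma> \<longleftrightarrow> arr \<sigma> ''mark'' S \<noteq> 0 \<and> arr \<sigma> ''mark'' Z = 0 \<and>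
     cut_arcs M (arr \<sigma> ''tl'') (arr \<sigma> ''hd'') {x. arr \<sigma> ''mark'' x \<noteq> 0} = {}"

lemma augment_spec:
  assumes regs: "reg \<sigma> ''S'' = S" "reg \<sigma> ''Z'' = Z" "reg \<sigma> ''NN'' = NN" "reg \<sigma> ''M'' = M"
    and SZ: "S < NN" "Z < NN" and less: "arcs_less NN M \<sigma>"
  defines "csize \<equiv> \<lambda>(\<sigma> :: state) A. card (cut_arcs M (arr \<sigma> ''tl'') (arr \<sigma> ''hd'') A)"
  shows "runs augment \<sigma> (900 * (M + NN + 1)) (\<lambda>\<sigma>'. arcs_less NN M \<sigma>' \<and>
    (reg \<sigma>' ''g'' = 0 \<and> closed_marks M S Z \<sigma>' \<and> csize \<sigma>' = csize \<sigma> \<or>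
     reg \<sigma>' ''g'' = reg \<sigma> ''g'' - 1 \<and> (\<forall>A. S \<in> A \<and> Z \<notin> A \<longrightarrow> csize \<sigma>' A + 1 = csize \<sigma> A)))"
    (is "runs _ _ _ ?Q")
proof -
  interpret arc_list NN M "arr \<sigma> ''tl''" "arr \<sigma> ''hd''" S
    using SZ less by unfold_locales (auto simp: arcs_less_def)
  let ?choice = "Cond (Equal (Rd ''mark'' (R ''Z'')) (N 0)) (Assign ''g'' (N 0))
       (reverse_path ;; Assign ''g'' (Minus (R ''g'') (N 1)))"
  let ?post = "\<lambda>\<sigma>'.
    (\<forall>x<NN. arr \<sigma>' ''mark'' x \<le> NN \<and> (arr \<sigma>' ''mark'' x = 1 \<longleftrightarrow> x = S)) \<and>
    (\<forall>b<M. arr \<sigma>' ''mark'' (arr \<sigma> ''tl'' b) \<noteq> 0 \<longrightarrow> arr \<sigma>' ''mark'' (arr \<sigma> ''hd'' b) \<noteq> 0) \<and>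
    (\<forall>y<NN. 1 < arr \<sigma>' ''mark'' y \<longrightarrow>
      (\<exists>b<M. arr \<sigma>' ''par'' y = Suc b \<and> arr \<sigma> ''hd'' b = y \<and>
        1 \<le> arr \<sigma>' ''mark'' (arr \<sigma> ''tl'' b) \<and>
        arr \<sigma>' ''mark'' (arr \<sigma> ''tl'' b) < arr \<sigma>' ''mark'' y))"
  \<comment> \<open>The phases are treated from the last to the first, since \<open>runs_Seq\<close>
    takes a statement about the remaining program as postcondition of the first part.\<close>
  have choice: "runs ?choice \<sigma>' (20 + 200 * (NN + 1)) ?Q"
    if post: "?post \<sigma>'" and
      eqs: "reg \<sigma>' ''S'' = S" "reg \<sigma>' ''Z'' = Z" "reg \<sigma>' ''g'' = reg \<sigma> ''g''"
        "arr \<sigma>' ''tl'' = arr \<sigma> ''tl''" "arr \<sigma>' ''hd'' = arr \<sigma> ''hd''" for \<sigma>'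
  proof (rule runs_mono[OF runs_Cond[where T = "10 + 200 * (NN + 1)"]])
    assume "bval (Equal (Rd ''mark'' (R ''Z'')) (N 0)) \<sigma>'"
    with post eqs less SZ show "runs (Assign ''g'' (N 0)) \<sigma>' (10 + 200 * (NN + 1)) ?Q"
      by (intro runs_loopfree)
         (auto simp: csize_def closed_marks_def cut_arcs_def arcs_less_def)
  next
    assume "\<not> bval (Equal (Rd ''mark'' (R ''Z'')) (N 0)) \<sigma>'"
    then have mZ: "arr \<sigma>' ''mark'' Z \<noteq> 0" using eqs by simp
    have p: "\<forall>x<NN. arr \<sigma>' ''mark'' x \<le> NN \<and> (arr \<sigma>' ''mark'' x = 1 \<longleftrightarrow> x = S)"
      "\<forall>y<NN. 1 < arr \<sigma>' ''mark'' y \<longrightarrow>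
      (\<exists>b<M. arr \<sigma>' ''par'' y = Suc b \<and> arr \<sigma> ''hd'' b = y \<and>
        1 \<le> arr \<sigma>' ''mark'' (arr \<sigma> ''tl'' b) \<and>
        arr \<sigma>' ''mark'' (arr \<sigma> ''tl'' b) < arr \<sigma>' ''mark'' y)" using post by blast+
    have *: "runs (reverse_path ;; Assign ''g'' (Minus (R ''g'') (N 1))) \<sigma>' (1 + 200 * (NN + 1) + 4) ?Q"
    proof (rule runs_Seq[OF runs_mono[OF runs_frame[OF reverse_path_spec[OF eqs(1,2) SZ(2) eqs(4,5) refl refl p(1) mZ p(2)]] le_refl]])
      fix \<sigma>''
      assume "(arcs_less NN M \<sigma>'' \<and> (\<forall>A. S \<in> A \<and> Z \<notin> A \<longrightarrow>
          card (cut_arcs M (arr \<sigma>'' ''tl'') (arr \<sigma>'' ''hd'') A) + 1 =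
          card (cut_arcs M (arr \<sigma> ''tl'') (arr \<sigma> ''hd'') A))) \<and> frame reverse_path \<sigma>' \<sigma>''"
      with eqs show "runs (Assign ''g'' (Minus (R ''g'') (N 1))) \<sigma>'' 4 ?Q"
        by (intro runs_loopfree)
           (auto simp: csize_def frame_def reverse_path_def reverse_body_def arcs_less_def)
    qed
    show "runs (reverse_path ;; Assign ''g'' (Minus (R ''g'') (N 1))) \<sigma>' (10 + 200 * (NN + 1)) ?Q"
      by (rule runs_mono[OF *]) simp_all
  qed simp_all
  have after_link: "runs (search ;; ?choice) \<sigma>2 (1 + 200 * (M + NN + 1) + (20 + 200 * (NN + 1))) ?Q"
    if fr: "frame clear \<sigma> \<sigma>1" "frame link \<sigma>1 \<sigma>2"
      and mark: "\<forall>x<NN. arr \<sigma>1 ''mark'' x = 0"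
      and lists: "\<forall>x<NN. arr \<sigma>2 ''head'' x = last_arc (arr \<sigma> ''tl'') x M"
        "\<forall>b<M. arr \<sigma>2 ''nxt'' b = last_arc (arr \<sigma> ''tl'') (arr \<sigma> ''tl'' b) b" for \<sigma>1 \<sigma>2
  proof -
    from fr mark have eqs: "reg \<sigma>2 ''S'' = S" "reg \<sigma>2 ''Z'' = Z" "reg \<sigma>2 ''g'' = reg \<sigma> ''g''"
        "arr \<sigma>2 ''tl'' = arr \<sigma> ''tl''" "arr \<sigma>2 ''hd'' = arr \<sigma> ''hd''"
      and marks: "\<forall>x<NN. arr \<sigma>2 ''mark'' x = 0"
      using regs by (simp_all add: frame_def clear_def clear_body_def link_def link_body_def)
    show ?thesis
    proof (rule runs_Seq[OF runs_mono[OF search_spec[OF eqs(1,4,5) marks lists] le_refl]])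
      fix \<sigma>3 assume "frame search \<sigma>2 \<sigma>3 \<and> ?post \<sigma>3"
      with eqs show "runs ?choice \<sigma>3 (20 + 200 * (NN + 1)) ?Q"
        by (intro choice) (simp_all add: frame_def search_def search_init_def search_body_def)
    qed
  qed
  have after_clear: "runs (link ;; search ;; ?choice) \<sigma>1
      (1 + 100 * (M + 1) + (1 + 200 * (M + NN + 1) + (20 + 200 * (NN + 1)))) ?Q"
    if fr: "frame clear \<sigma> \<sigma>1"
      and zero: "\<forall>x<NN. arr \<sigma>1 ''mark'' x = 0 \<and> arr \<sigma>1 ''head'' x = 0" for \<sigma>1
  proof -
    from fr have eqs: "arr \<sigma>1 ''tl'' = arr \<sigma> ''tl''" "reg \<sigma>1 ''M'' = M"
      using regs by (simp_all add: frame_def clear_def clear_body_def)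
    have "runs link \<sigma>1 (100 * (M + 1)) (\<lambda>\<sigma>'. frame link \<sigma>1 \<sigma>' \<and>
      (\<forall>x<NN. arr \<sigma>' ''head'' x = last_arc (arr \<sigma> ''tl'') x M) \<and>
      (\<forall>b<M. arr \<sigma>' ''nxt'' b = last_arc (arr \<sigma> ''tl'') (arr \<sigma> ''tl'' b) b))"
      using link_spec[of \<sigma>1 M NN, unfolded eqs(1)] eqs(2) zero tail_less by blast
    from runs_mono[OF this le_refl] show ?thesis
    proof (rule runs_Seq)
      fix \<sigma>2 assume "frame link \<sigma>1 \<sigma>2 \<and>
        (\<forall>x<NN. arr \<sigma>2 ''head'' x = last_arc (arr \<sigma> ''tl'') x M) \<and>
        (\<forall>b<M. arr \<sigma>2 ''nxt'' b = last_arc (arr \<sigma> ''tl'') (arr \<sigma> ''tl'' b) b)"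
      with after_link[OF fr] zero
      show "runs (search ;; ?choice) \<sigma>2 (1 + 200 * (M + NN + 1) + (20 + 200 * (NN + 1))) ?Q"
        by blast
    qed
  qed
  have "runs augment \<sigma> (1 + 100 * (NN + 1) + (1 + 100 * (M + 1) +
      (1 + 200 * (M + NN + 1) + (20 + 200 * (NN + 1))))) ?Q"
    unfolding augment_def
    by (rule runs_Seq[OF runs_mono[OF clear_spec[OF regs(3)] le_refl]]) (blast intro: after_clear)
  then show ?thesis by (rule runs_mono) simp_all
qed

text \<open>With \<open>k\<close> the number of reversals so far, every separating set
  \<open>A\<close> has a current cut of \<open>csize A - k\<close> arcs. If the marks are closed,
  the current cut of \<open>X\<close> is empty, so \<open>csize X = k\<close>, a lower bound for
  every \<open>csize A\<close>. If the counter has run out instead, then \<open>k = NN + 1\<close>,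
  which an initial cut of at most \<open>NN\<close> arcs forbids.\<close>

lemma max_flow_spec:
  assumes regs: "reg \<sigma> ''S'' = S" "reg \<sigma> ''Z'' = Z" "reg \<sigma> ''NN'' = NN" "reg \<sigma> ''M'' = M"
    and SZ: "S < NN" "Z < NN" and less: "arcs_less NN M \<sigma>"
  defines "csize \<equiv> \<lambda>A. card (cut_arcs M (arr \<sigma> ''tl'') (arr \<sigma> ''hd'') A)"
  shows "runs max_flow \<sigma> (1000 * (M + NN + 1) * (NN + 2) + 10) (\<lambda>\<sigma>'. frame max_flow \<sigma> \<sigma>' \<and>
    (let X = {x. arr \<sigma>' ''mark'' x \<noteq> 0} in
      (\<exists>A. S \<in> A \<and> Z \<notin> A \<and> csize A \<le> NN) \<longrightarrow>
      S \<in> X \<and> Z \<notin> X \<and> (\<forall>A. S \<in> A \<and> Z \<notin> A \<longrightarrow> csize X \<le> csize A)))"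
proof -
  let ?init = "Assign ''g'' (Plus (R ''NN'') (N 1))" and ?b = "Less (N 0) (R ''g'')"
  let ?cut = "\<lambda>(\<sigma>' :: state) A. card (cut_arcs M (arr \<sigma>' ''tl'') (arr \<sigma>' ''hd'') A)"
  let ?I = "\<lambda>\<sigma>'. arcs_less NN M \<sigma>' \<and>
    (\<exists>k. (\<forall>A. S \<in> A \<and> Z \<notin> A \<longrightarrow> ?cut \<sigma>' A + k = csize A) \<and>
       (k + reg \<sigma>' ''g'' = NN + 1 \<or> reg \<sigma>' ''g'' = 0 \<and> closed_marks M S Z \<sigma>'))"
  have "runs max_flow \<sigma> (1 + lfcost ?init + 1000 * (M + NN + 1) * (NN + 1 + 1))
    (\<lambda>\<sigma>'. ?I \<sigma>' \<and> \<not> bval ?b \<sigma>' \<and> frame augment (lfsem ?init \<sigma>) \<sigma>')"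
    unfolding max_flow_def
  proof (intro runs_Seq_loopfree runs_While[where I = ?I and \<phi> = "\<lambda>\<sigma>'. reg \<sigma>' ''g''" and C = "900 * (M + NN + 1)"],
      goal_cases)
    \<comment> \<open>Case 2 is the invariant on entry, with no reversals made; case 5 is one
      round.\<close>
    case 2
    then show ?case using less regs by (auto simp: csize_def arcs_less_def intro!: exI[of _ 0])
  next
    case (5 \<sigma>1)
    then have eqs: "reg \<sigma>1 ''S'' = S" "reg \<sigma>1 ''Z'' = Z" "reg \<sigma>1 ''NN'' = NN" "reg \<sigma>1 ''M'' = M"
      using regs by (simp_all add: frame_def augment_def clear_def clear_body_def link_def link_body_def
        search_def search_init_def search_body_def reverse_path_def reverse_body_def)
    from 5 obtain k where k: "\<forall>A. S \<in> A \<and> Z \<notin> A \<longrightarrow> ?cut \<sigma>1 A + k = csize A"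
      "k + reg \<sigma>1 ''g'' = NN + 1" and g: "0 < reg \<sigma>1 ''g''" and l: "arcs_less NN M \<sigma>1" by auto
    from augment_spec[OF eqs SZ l] show ?case
    proof (rule runs_mono[OF _ le_refl])
      fix \<sigma>2
      assume *: "arcs_less NN M \<sigma>2 \<and>
        (reg \<sigma>2 ''g'' = 0 \<and> closed_marks M S Z \<sigma>2 \<and> ?cut \<sigma>2 = ?cut \<sigma>1 \<or>
         reg \<sigma>2 ''g'' = reg \<sigma>1 ''g'' - 1 \<and>
           (\<forall>A. S \<in> A \<and> Z \<notin> A \<longrightarrow> ?cut \<sigma>2 A + 1 = ?cut \<sigma>1 A))"
      then show "?I \<sigma>2 \<and> reg \<sigma>2 ''g'' < reg \<sigma>1 ''g''"
      proof (elim conjE disjE)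
        assume "reg \<sigma>2 ''g'' = 0" "closed_marks M S Z \<sigma>2" "?cut \<sigma>2 = ?cut \<sigma>1"
        from fun_cong[OF this(3)] this(1,2) * k(1) g show ?thesis
          by (intro conjI exI[of _ k]) auto
      next
        assume "reg \<sigma>2 ''g'' = reg \<sigma>1 ''g'' - 1"
          "\<forall>A. S \<in> A \<and> Z \<notin> A \<longrightarrow> ?cut \<sigma>2 A + 1 = ?cut \<sigma>1 A"
        moreover from this(2) k(1) have "\<forall>A. S \<in> A \<and> Z \<notin> A \<longrightarrow> ?cut \<sigma>2 A + Suc k = csize A"
          by (metis add_Suc_right add_Suc_shift Suc_eq_plus1)
        ultimately show ?thesis using * k(2) g by (intro conjI exI[of _ "Suc k"]) auto
      qed
    qed
  qed (use regs in simp_all)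
  from runs_frame[OF this] show ?thesis
  proof (rule runs_mono)
    fix \<sigma>' assume *: "(?I \<sigma>' \<and> \<not> bval ?b \<sigma>' \<and> frame augment (lfsem ?init \<sigma>) \<sigma>') \<and> frame max_flow \<sigma> \<sigma>'"
    let ?X = "{x. arr \<sigma>' ''mark'' x \<noteq> 0}"
    from * obtain k where k: "\<forall>A. S \<in> A \<and> Z \<notin> A \<longrightarrow> ?cut \<sigma>' A + k = csize A"
      and stop: "k + reg \<sigma>' ''g'' = NN + 1 \<or> reg \<sigma>' ''g'' = 0 \<and> closed_marks M S Z \<sigma>'" by blast
    from * have "reg \<sigma>' ''g'' = 0" by simp
    with stop have k2: "k = NN + 1 \<or> closed_marks M S Z \<sigma>'" by simp
    have "S \<in> ?X \<and> Z \<notin> ?X \<and> (\<forall>A. S \<in> A \<and> Z \<notin> A \<longrightarrow> csize ?X \<le> csize A)"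
      if A0: "S \<in> A0" "Z \<notin> A0" "csize A0 \<le> NN" for A0
    proof -
      from k A0 have "?cut \<sigma>' A0 + k \<le> NN" by auto
      then have "k \<noteq> NN + 1" by linarith
      with k2 have cl: "closed_marks M S Z \<sigma>'" by blast
      then have X: "S \<in> ?X \<and> Z \<notin> ?X" and "?cut \<sigma>' ?X = 0"
        unfolding closed_marks_def by auto
      from k[rule_format, OF X] have "?cut \<sigma>' ?X + k = csize ?X" .
      with \<open>?cut \<sigma>' ?X = 0\<close> have Xk: "csize ?X = k" by linarith
      have "csize ?X \<le> csize A" if "S \<in> A \<and> Z \<notin> A" for A
        unfolding Xk k[rule_format, OF that, symmetric] by (rule le_add2)
      with X show ?thesis by blast
    qed
    with * show "frame max_flow \<sigma> \<sigma>' \<and> (let X = ?X in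
      (\<exists>A. S \<in> A \<and> Z \<notin> A \<and> csize A \<le> NN) \<longrightarrow>
      S \<in> X \<and> Z \<notin> X \<and> (\<forall>A. S \<in> A \<and> Z \<notin> A \<longrightarrow> csize X \<le> csize A))" unfolding Let_def by blast
  qed simp
qed

section \<open>The time-expanded network\<close>

text \<open>A vertex \<open>v\<close> owns the nodes \<open>v * L + j\<close> with \<open>j < L\<close>, where \<open>2 * i - 2\<close> and \<open>2 * i - 1\<close> are
  the entry and the exit of \<open>v\<close> at time \<open>i\<close>. They form a chain, whose arcs come first in the
  numbering of arcs. The vertices \<open>s\<close> and \<open>z\<close> are collapsed to their first node. Arcs which do not
  matter are loops: these never cross a cut.\<close>

locale network =
  fixes n m tau s z t :: nat and src tgt tm :: "nat \<Rightarrow> nat"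
  assumes s_less: "s < n" and z_less: "z < n" and s_neq_z: "s \<noteq> z" and tau_pos: "1 \<le> tau"
    and src_less: "e < m \<Longrightarrow> src e < n" and tgt_less: "e < m \<Longrightarrow> tgt e < n"
    and tm_pos: "e < m \<Longrightarrow> 1 \<le> tm e" and tm_le: "e < m \<Longrightarrow> tm e \<le> tau"
begin

definition L :: nat where "L = 2 * tau"
definition NN :: nat where "NN = n * L"
definition M :: nat where "M = NN + m"

definition chain_head :: "nat \<Rightarrow> nat" where
  "chain_head q = (if q div L = s \<or> q div L = z \<or> L \<le> Suc (q mod L) then q else Suc q)"

text \<open>For a path with first label \<open>w\<close>, travelling time at most \<open>t\<close>
  means labels below \<open>w + t\<close>. A path from \<open>s\<close> to \<open>z\<close> without
  repeated vertices neither enters \<open>s\<close> nor leaves \<open>z\<close>.\<close>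

definition live :: "nat \<Rightarrow> nat \<Rightarrow> bool" where
  "live w e \<longleftrightarrow> w \<le> tm e \<and> tm e < w + t \<and> tgt e \<noteq> s \<and> src e \<noteq> z"

definition edge_tail :: "nat \<Rightarrow> nat \<Rightarrow> nat" where
  "edge_tail w e = (if live w e
     then if src e = s then s * L else src e * L + 2 * tm e - 1 else 0)"

definition edge_head :: "nat \<Rightarrow> nat \<Rightarrow> nat" where
  "edge_head w e = (if live w e
     then if tgt e = z then z * L else tgt e * L + 2 * tm e - 2 else 0)"

definition arc_tail :: "nat \<Rightarrow> nat \<Rightarrow> nat" where
  "arc_tail w a = (if a < NN then a else edge_tail w (a - NN))"

definition arc_head :: "nat \<Rightarrow> nat \<Rightarrow> nat" where
  "arc_head w a = (if a < NN then chain_head a else edge_head w (a - NN))"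

text \<open>The vertex to be deleted if the arc crosses the cut. A live arc does not enter
  \<open>s\<close>, so its target is a candidate unless it is \<open>z\<close>; in that case the
  source is taken, which is \<open>s\<close> only for an edge from \<open>s\<close> to
  \<open>z\<close>.\<close>

definition arc_label :: "nat \<Rightarrow> nat" where
  "arc_label a = (if a < NN then a div L
     else if tgt (a - NN) = z then src (a - NN) else tgt (a - NN))"

abbreviation window_cut :: "nat \<Rightarrow> nat set \<Rightarrow> nat set" where
  "window_cut w \<equiv> cut_arcs M (arc_tail w) (arc_head w)"

definition min_cut :: "nat \<Rightarrow> nat set \<Rightarrow> bool" where
  "min_cut w X \<longleftrightarrow> s * L \<in> X \<and> z * L \<notin> X \<and>
     (\<forall>A. s * L \<in> A \<and> z * L \<notin> A \<longrightarrow> card (window_cut w X) \<le> card (window_cut w A))"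

text \<open>The bound \<open>NN\<close> is one below the initial value of the round counter in
  \<open>max_flow\<close>.\<close>

definition small_cut :: "nat \<Rightarrow> bool" where
  "small_cut w \<longleftrightarrow> (\<exists>A. s * L \<in> A \<and> z * L \<notin> A \<and> card (window_cut w A) \<le> NN)"

lemma L_pos: "2 \<le> L"
  using tau_pos by (simp add: L_def)

lemma node_less: "v < n \<Longrightarrow> j < L \<Longrightarrow> v * L + j < NN"
proof -
  assume "v < n" "j < L"
  then have "v * L + j < Suc v * L" by simp
  also have "\<dots> \<le> n * L" using \<open>v < n\<close> by (intro mult_le_mono1) simp
  finally show ?thesis by (simp add: NN_def)
qed

lemma node_div: "j < L \<Longrightarrow> (v * L + j) div L = v"
  and node_mod: "j < L \<Longrightarrow> (v * L + j) mod L = j"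
  by simp_all

lemma source_sink_less: "s * L < NN" "z * L < NN"
  using node_less[of s 0] node_less[of z 0] s_less z_less L_pos by simp_all

lemma chain_head_less: "q < NN \<Longrightarrow> chain_head q < NN"
proof (cases "L \<le> Suc (q mod L)")
  case False
  assume "q < NN"
  then have "q div L < n" by (simp add: NN_def less_mult_imp_div_less)
  with False have "q div L * L + Suc (q mod L) < NN" by (intro node_less) simp_all
  then show ?thesis using \<open>q < NN\<close> by (simp add: chain_head_def)
qed (simp add: chain_head_def)

lemma exit_less: "e < m \<Longrightarrow> 2 * tm e - 1 < L"
  and entry_less: "e < m \<Longrightarrow> 2 * tm e - 2 < L"
  using tm_pos[of e] tm_le[of e] by (simp_all add: L_def)

lemma edge_tail_eq: "e < m \<Longrightarrow> live w e \<Longrightarrow> src e \<noteq> s \<Longrightarrow> edge_tail w e = src e * L + (2 * tm e - 1)"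
  and edge_head_eq: "e < m \<Longrightarrow> live w e \<Longrightarrow> tgt e \<noteq> z \<Longrightarrow> edge_head w e = tgt e * L + (2 * tm e - 2)"
  using tm_pos[of e] by (simp_all add: edge_tail_def edge_head_def)

lemma arc_less:
  assumes "a < M"
  shows "arc_tail w a < NN \<and> arc_head w a < NN"
proof (cases "a < NN")
  case True
  then show ?thesis by (simp add: arc_tail_def arc_head_def chain_head_less)
next
  case False
  with assms have e: "a - NN < m" by (simp add: M_def)
  have "edge_tail w (a - NN) < NN"
    using e edge_tail_eq[OF e, of w] node_less[OF src_less[OF e] exit_less[OF e]] source_sink_less
    by (cases "live w (a - NN)"; cases "src (a - NN) = s") (auto simp: edge_tail_def)
  moreover have "edge_head w (a - NN) < NN"
    using e edge_head_eq[OF e, of w] node_less[OF tgt_less[OF e] entry_less[OF e]] source_sink_less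
    by (cases "live w (a - NN)"; cases "tgt (a - NN) = z") (auto simp: edge_head_def)
  ultimately show ?thesis using False by (simp add: arc_tail_def arc_head_def)
qed

section \<open>Construction of the network by the program\<close>

definition inputs :: "state \<Rightarrow> bool" where
  "inputs \<sigma> \<longleftrightarrow> reg \<sigma> ''n'' = n \<and> reg \<sigma> ''m'' = m \<and> reg \<sigma> ''tau'' = tau \<and> reg \<sigma> ''s'' = s \<and>
     reg \<sigma> ''z'' = z \<and> reg \<sigma> ''t'' = t \<and>
     (\<forall>e<m. arr \<sigma> ''src'' e = src e \<and> arr \<sigma> ''tgt'' e = tgt e \<and> arr \<sigma> ''time'' e = tm e)"

definition layout_done :: "state \<Rightarrow> bool" where
  "layout_done \<sigma> \<longleftrightarrow> inputs \<sigma> \<and> reg \<sigma> ''NN'' = NN \<and> reg \<sigma> ''M'' = M \<and>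
     reg \<sigma> ''S'' = s * L \<and> reg \<sigma> ''Z'' = z * L \<and> (\<forall>v<n. arr \<sigma> ''bs'' v = v * L) \<and>
     (\<forall>q<NN. arr \<sigma> ''A'' q = q \<and> arr \<sigma> ''B'' q = chain_head q \<and> arr \<sigma> ''lab'' q = q div L)"

lemma layout_spec:
  assumes "inputs \<sigma>"
  shows "runs layout \<sigma> (300 * (NN + 1)) (\<lambda>\<sigma>'. frame layout \<sigma> \<sigma>' \<and> layout_done \<sigma>')"
proof -
  let ?b = "Less (R ''v'') (R ''n'')"
  \<comment> \<open>The clause that \<open>v = n\<close> forces \<open>j = 0\<close> turns
    \<open>q = v * L + j\<close> into \<open>q = NN\<close> on exit.\<close>
  let ?I = "\<lambda>\<sigma>'. let v = reg \<sigma>' ''v''; j = reg \<sigma>' ''j''; q = reg \<sigma>' ''q'' in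
    q = v * L + j \<and> j < L \<and> v \<le> n \<and> (v = n \<longrightarrow> j = 0) \<and> reg \<sigma>' ''L'' = L \<and>
    (\<forall>q'<q. arr \<sigma>' ''A'' q' = q' \<and> arr \<sigma>' ''B'' q' = chain_head q' \<and>
       arr \<sigma>' ''lab'' q' = q' div L \<and> arr \<sigma>' ''bs'' (q' div L) = q' div L * L)"
  let ?phi = "\<lambda>\<sigma>'. NN - reg \<sigma>' ''q''"
  have init: "?I (lfsem layout_init \<sigma>)"
    using assms L_pos by (simp add: layout_init_def inputs_def L_def)
  have step: "?I (lfsem layout_body \<sigma>1) \<and> ?phi (lfsem layout_body \<sigma>1) < ?phi \<sigma>1"
    if I: "?I \<sigma>1" and b: "bval ?b \<sigma>1" and fr: "frame layout_body (lfsem layout_init \<sigma>) \<sigma>1" for \<sigma>1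
  proof -
    have r: "reg \<sigma>1 ''n'' = n" "reg \<sigma>1 ''s'' = s" "reg \<sigma>1 ''z'' = z"
      using assms fr by (simp_all add: frame_def layout_body_def layout_init_def inputs_def)
    define v j where "v = reg \<sigma>1 ''v''" and "j = reg \<sigma>1 ''j''"
    note vj = this
    have v: "v < n" using b r by (simp add: vj)
    have j: "j < L" and q: "reg \<sigma>1 ''q'' = v * L + j" and rL: "reg \<sigma>1 ''L'' = L"
      and old: "\<And>q'. q' < v * L + j \<Longrightarrow> arr \<sigma>1 ''A'' q' = q' \<and> arr \<sigma>1 ''B'' q' = chain_head q' \<and>
       arr \<sigma>1 ''lab'' q' = q' div L \<and> arr \<sigma>1 ''bs'' (q' div L) = q' div L * L"
      using I unfolding Let_def vj by auto
    let ?s = "lfsem layout_body \<sigma>1"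
    have new: "reg ?s ''q'' = Suc (v * L + j)" "reg ?s ''L'' = L"
      "arr ?s ''A'' = (arr \<sigma>1 ''A'')(v * L + j := v * L + j)"
      "arr ?s ''B'' = (arr \<sigma>1 ''B'')(v * L + j := chain_head (v * L + j))"
      "arr ?s ''lab'' = (arr \<sigma>1 ''lab'')(v * L + j := v)"
      "arr ?s ''bs'' = (arr \<sigma>1 ''bs'')(v := v * L)"
      "reg ?s ''v'' = (if Suc j = L then Suc v else v)"
      "reg ?s ''j'' = (if Suc j = L then 0 else Suc j)"
      using j by (auto simp: layout_body_def vj[symmetric] q rL r chain_head_def)
    have "arr ?s ''A'' q' = q' \<and> arr ?s ''B'' q' = chain_head q' \<and>
       arr ?s ''lab'' q' = q' div L \<and> arr ?s ''bs'' (q' div L) = q' div L * L"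
      if "q' < Suc (v * L + j)" for q'
    proof (cases "q' = v * L + j")
      case True
      then show ?thesis unfolding new using j by simp
    next
      case False
      with that old[of q'] show ?thesis unfolding new by auto
    qed
    moreover have "v * L + j < NN" using v j by (rule node_less)
    ultimately show ?thesis
      unfolding Let_def new using j v q L_pos by auto
  qed
  have "runs layout \<sigma> (1 + lfcost layout_init + (1 + 200 * (NN + 1) + lfcost layout_final)) layout_done"
    unfolding layout_def
  proof (intro runs_Seq_loopfree runs_Seq)
    have "runs (While ?b layout_body) (lfsem layout_init \<sigma>) (200 * (NN + 1))
      (\<lambda>\<sigma>'. ?I \<sigma>' \<and> \<not> bval ?b \<sigma>' \<and> frame layout_body (lfsem layout_init \<sigma>) \<sigma>')"
      by (intro runs_While_loopfree[where \<phi> = ?phi] init step) (simp_all add: layout_body_def)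
    then show "runs (While ?b layout_body) (lfsem layout_init \<sigma>) (200 * (NN + 1))
      (\<lambda>\<sigma>'. runs layout_final \<sigma>' (lfcost layout_final) layout_done)"
    proof (rule runs_mono[OF _ le_refl])
      fix \<sigma>' assume *: "?I \<sigma>' \<and> \<not> bval ?b \<sigma>' \<and> frame layout_body (lfsem layout_init \<sigma>) \<sigma>'"
      then have inp: "inputs \<sigma>'"
        using assms by (simp add: frame_def layout_body_def layout_init_def inputs_def)
      with * have "reg \<sigma>' ''v'' = n" by (auto simp: Let_def inputs_def)
      with * have q: "reg \<sigma>' ''q'' = NN" and old: "\<forall>q'<NN. arr \<sigma>' ''A'' q' = q' \<and>
        arr \<sigma>' ''B'' q' = chain_head q' \<and>
        arr \<sigma>' ''lab'' q' = q' div L \<and> arr \<sigma>' ''bs'' (q' div L) = q' div L * L"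
        by (auto simp: Let_def NN_def)
      have bs: "arr \<sigma>' ''bs'' v = v * L" if "v < n" for v
        using old[rule_format, of "v * L"] node_less[OF that, of 0] L_pos by simp
      show "runs layout_final \<sigma>' (lfcost layout_final) layout_done"
        using inp q old bs s_less z_less
        by (intro runs_loopfree) (simp_all add: layout_final_def layout_done_def inputs_def M_def)
    qed
  qed (simp add: layout_init_def)
  from runs_frame[OF this] show ?thesis
    by (rule runs_mono) (simp_all add: layout_init_def layout_final_def)
qed

text \<open>Only the arcs from \<open>NN\<close> on depend on the window. The chain arcs left by
  \<open>layout\<close> satisfy the invariant from the start.\<close>

lemma edge_arcs_spec:
  assumes "layout_done \<sigma>" and w: "reg \<sigma> ''w'' = w"
  shows "runs edge_arcs \<sigma> (200 * (m + 1)) (\<lambda>\<sigma>'. frame edge_arcs \<sigma> \<sigma>' \<and>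
    (\<forall>a<M. arr \<sigma>' ''A'' a = arc_tail w a \<and> arr \<sigma>' ''B'' a = arc_head w a \<and>
       arr \<sigma>' ''lab'' a = arc_label a))"
proof -
  let ?init = "Assign ''e'' (N 0) ;; Assign ''a'' (R ''NN'')" and ?b = "Less (R ''e'') (R ''m'')"
  let ?I = "\<lambda>\<sigma>'. let e = reg \<sigma>' ''e'' in e \<le> m \<and> reg \<sigma>' ''a'' = NN + e \<and>
    (\<forall>a<NN + e. arr \<sigma>' ''A'' a = arc_tail w a \<and> arr \<sigma>' ''B'' a = arc_head w a \<and>
       arr \<sigma>' ''lab'' a = arc_label a)"
  let ?phi = "\<lambda>\<sigma>'. m - reg \<sigma>' ''e''"
  have init: "?I (lfsem ?init \<sigma>)"
    using assms by (simp add: layout_done_def arc_tail_def arc_head_def arc_label_def)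
  have step: "?I (lfsem edges_body \<sigma>1) \<and> ?phi (lfsem edges_body \<sigma>1) < ?phi \<sigma>1"
    if I: "?I \<sigma>1" and b: "bval ?b \<sigma>1" and fr: "frame edges_body (lfsem ?init \<sigma>) \<sigma>1" for \<sigma>1
  proof -
    have r: "reg \<sigma>1 ''m'' = m" "reg \<sigma>1 ''s'' = s" "reg \<sigma>1 ''z'' = z" "reg \<sigma>1 ''t'' = t"
      "reg \<sigma>1 ''w'' = w" "reg \<sigma>1 ''S'' = s * L" "reg \<sigma>1 ''Z'' = z * L"
      "\<forall>v<n. arr \<sigma>1 ''bs'' v = v * L"
      "\<forall>e<m. arr \<sigma>1 ''src'' e = src e \<and> arr \<sigma>1 ''tgt'' e = tgt e \<and> arr \<sigma>1 ''time'' e = tm e"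
      using assms fr by (simp_all add: frame_def edges_body_def layout_done_def inputs_def)
    define e where "e = reg \<sigma>1 ''e''"
    have e: "e < m" using b r by (simp add: e_def)
    have a: "reg \<sigma>1 ''a'' = NN + e" and old: "\<And>a. a < NN + e \<Longrightarrow> arr \<sigma>1 ''A'' a = arc_tail w a \<and>
        arr \<sigma>1 ''B'' a = arc_head w a \<and> arr \<sigma>1 ''lab'' a = arc_label a"
      using I unfolding Let_def e_def by auto
    have rd: "arr \<sigma>1 ''src'' e = src e" "arr \<sigma>1 ''tgt'' e = tgt e" "arr \<sigma>1 ''time'' e = tm e"
      "arr \<sigma>1 ''bs'' (src e) = src e * L" "arr \<sigma>1 ''bs'' (tgt e) = tgt e * L"
      using r e src_less tgt_less by auto
    let ?s = "lfsem edges_body \<sigma>1"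
    have new: "reg ?s ''e'' = Suc e" "reg ?s ''a'' = NN + Suc e"
      "arr ?s ''A'' = (arr \<sigma>1 ''A'')(NN + e := edge_tail w e)"
      "arr ?s ''B'' = (arr \<sigma>1 ''B'')(NN + e := edge_head w e)"
      "arr ?s ''lab'' = (arr \<sigma>1 ''lab'')(NN + e := if tgt e = z then src e else tgt e)"
      by (auto simp: edges_body_def e_def[symmetric] rd r a edge_tail_def edge_head_def live_def
          mult_2 split: if_splits)
    have "arr ?s ''A'' a = arc_tail w a \<and> arr ?s ''B'' a = arc_head w a \<and> arr ?s ''lab'' a = arc_label a"
      if "a < NN + Suc e" for a
    proof (cases "a = NN + e")
      case True
      then show ?thesis unfolding new by (simp add: arc_tail_def arc_head_def arc_label_def)
    next
      case False
      with that old[of a] show ?thesis unfolding new by auto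
    qed
    then show ?thesis unfolding Let_def new using e by (auto simp: e_def)
  qed
  have "runs edge_arcs \<sigma> (1 + lfcost ?init + 150 * (m + 1))
    (\<lambda>\<sigma>'. ?I \<sigma>' \<and> \<not> bval ?b \<sigma>' \<and> frame edges_body (lfsem ?init \<sigma>) \<sigma>')"
    unfolding edge_arcs_def
    by (intro runs_Seq_loopfree runs_While_loopfree[where \<phi> = ?phi] init step)
       (simp_all add: edges_body_def)
  from runs_frame[OF this] show ?thesis
  proof (rule runs_mono)
    fix \<sigma>' assume *: "(?I \<sigma>' \<and> \<not> bval ?b \<sigma>' \<and> frame edges_body (lfsem ?init \<sigma>) \<sigma>') \<and> frame edge_arcs \<sigma> \<sigma>'"
    from * have "frame edges_body (lfsem ?init \<sigma>) \<sigma>'" by blast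
    then have "reg \<sigma>' ''m'' = m"
      using assms by (simp add: frame_def edges_body_def layout_done_def inputs_def)
    with * have e: "reg \<sigma>' ''e'' = m" by (simp add: Let_def)
    from * have "\<forall>a<NN + reg \<sigma>' ''e''. arr \<sigma>' ''A'' a = arc_tail w a \<and>
      arr \<sigma>' ''B'' a = arc_head w a \<and> arr \<sigma>' ''lab'' a = arc_label a" unfolding Let_def by blast
    with * e show "frame edge_arcs \<sigma> \<sigma>' \<and> (\<forall>a<M. arr \<sigma>' ''A'' a = arc_tail w a \<and>
      arr \<sigma>' ''B'' a = arc_head w a \<and> arr \<sigma>' ''lab'' a = arc_label a)"
      unfolding M_def by simp
  qed simp
qed

end

text \<open>\<open>sep\<close> is never reset, so the labels of all windows accumulate. Crossing is
  tested on \<open>A\<close> and \<open>B\<close>, which the reversals have not touched.\<close>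

lemma collect_spec:
  assumes "reg \<sigma> ''M'' = M"
  shows "runs collect \<sigma> (100 * (M + 1)) (\<lambda>\<sigma>'. frame collect \<sigma> \<sigma>' \<and>
    (\<forall>v. arr \<sigma>' ''sep'' v \<noteq> 0 \<longleftrightarrow> arr \<sigma> ''sep'' v \<noteq> 0 \<or>
      (\<exists>a\<in>cut_arcs M (arr \<sigma> ''A'') (arr \<sigma> ''B'') {x. arr \<sigma> ''mark'' x \<noteq> 0}. arr \<sigma> ''lab'' a = v)))"
proof -
  let ?init = "Assign ''a'' (N 0)" and ?b = "Less (R ''a'') (R ''M'')"
  let ?cross = "\<lambda>a. arr \<sigma> ''mark'' (arr \<sigma> ''A'' a) \<noteq> 0 \<and> arr \<sigma> ''mark'' (arr \<sigma> ''B'' a) = 0"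
  let ?I = "\<lambda>\<sigma>'. reg \<sigma>' ''a'' \<le> M \<and>
    (\<forall>v. arr \<sigma>' ''sep'' v \<noteq> 0 \<longleftrightarrow> arr \<sigma> ''sep'' v \<noteq> 0 \<or>
      (\<exists>a<reg \<sigma>' ''a''. ?cross a \<and> arr \<sigma> ''lab'' a = v))"
  have "runs collect \<sigma> (1 + lfcost ?init + 50 * (M + 1))
    (\<lambda>\<sigma>'. ?I \<sigma>' \<and> \<not> bval ?b \<sigma>' \<and> frame collect_body (lfsem ?init \<sigma>) \<sigma>')"
    unfolding collect_def
    by (intro runs_Seq_loopfree runs_While_loopfree[where I = ?I and \<phi> = "\<lambda>\<sigma>. M - reg \<sigma> ''a''"])
       (use assms in \<open>auto simp: collect_body_def frame_def less_Suc_eq\<close>)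
  from runs_frame[OF this] show ?thesis
  proof (rule runs_mono)
    fix \<sigma>' assume *: "(?I \<sigma>' \<and> \<not> bval ?b \<sigma>' \<and> frame collect_body (lfsem ?init \<sigma>) \<sigma>') \<and> frame collect \<sigma> \<sigma>'"
    then have "reg \<sigma>' ''a'' = M"
      using assms by (auto simp: frame_def collect_body_def)
    with * show "frame collect \<sigma> \<sigma>' \<and> (\<forall>v. arr \<sigma>' ''sep'' v \<noteq> 0 \<longleftrightarrow> arr \<sigma> ''sep'' v \<noteq> 0 \<or>
      (\<exists>a\<in>cut_arcs M (arr \<sigma> ''A'') (arr \<sigma> ''B'') {x. arr \<sigma> ''mark'' x \<noteq> 0}. arr \<sigma> ''lab'' a = v))"
      by (auto simp: cut_arcs_def)
  qed simp
qed

section \<open>A single window, the loop over all windows, and the time bound\<close>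

context network
begin

definition window_arcs :: "nat \<Rightarrow> state \<Rightarrow> bool" where
  "window_arcs w \<sigma> \<longleftrightarrow> layout_done \<sigma> \<and> reg \<sigma> ''w'' = w \<and>
    (\<forall>a<M. arr \<sigma> ''A'' a = arc_tail w a \<and> arr \<sigma> ''B'' a = arc_head w a \<and>
       arr \<sigma> ''lab'' a = arc_label a)"

text \<open>\<open>A\<close>, \<open>B\<close> and \<open>lab\<close> are left out of the
  disjointness test because \<open>edge_arcs\<close> writes to them above \<open>NN\<close>; their
  initial segments are supplied by the last assumption.\<close>

lemma layout_done_frame:
  assumes "layout_done \<sigma>" "frame P \<sigma> \<sigma>'"
    "{''n'', ''m'', ''tau'', ''s'', ''z'', ''t'', ''NN'', ''M'', ''S'', ''Z''} \<inter> wregs P = {}"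
    "{''src'', ''tgt'', ''time'', ''bs''} \<inter> warrs P = {}"
    "\<forall>q<NN. arr \<sigma>' ''A'' q = q \<and> arr \<sigma>' ''B'' q = chain_head q \<and> arr \<sigma>' ''lab'' q = q div L"
  shows "layout_done \<sigma>'"
  using assms unfolding layout_done_def inputs_def frame_def by simp

lemma window_arcs_frame:
  assumes "window_arcs w \<sigma>" "frame P \<sigma> \<sigma>'"
    "{''n'', ''m'', ''tau'', ''s'', ''z'', ''t'', ''NN'', ''M'', ''S'', ''Z'', ''w''} \<inter> wregs P = {}"
    "{''src'', ''tgt'', ''time'', ''bs'', ''A'', ''B'', ''lab''} \<inter> warrs P = {}"
  shows "window_arcs w \<sigma>'"
proof -
  have "arr \<sigma>' ''A'' = arr \<sigma> ''A''" "arr \<sigma>' ''B'' = arr \<sigma> ''B''" "arr \<sigma>' ''lab'' = arr \<sigma> ''lab''"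
    "reg \<sigma>' ''w'' = reg \<sigma> ''w''"
    using assms(2-4) by (simp_all add: frame_def)
  moreover have "layout_done \<sigma>'"
    by (rule layout_done_frame[OF _ assms(2)])
       (use assms calculation in \<open>auto simp: window_arcs_def layout_done_def\<close>)
  ultimately show ?thesis using assms(1) by (simp add: window_arcs_def)
qed

lemma max_flow_regs: "wregs max_flow = {''g'', ''q'', ''a'', ''h'', ''k'', ''y'', ''x''}"
  and max_flow_arrs: "warrs max_flow = {''mark'', ''head'', ''nxt'', ''qu'', ''par'', ''tl'', ''hd''}"
  by (auto simp: max_flow_def augment_def clear_def clear_body_def link_def link_body_def
      search_def search_init_def search_body_def reverse_path_def reverse_body_def)

lemma window_spec:
  assumes laid: "layout_done \<sigma>" and w: "reg \<sigma> ''w'' = w"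
  shows "runs window \<sigma> (2000 * (M + NN + 1) * (NN + 2)) (\<lambda>\<sigma>'. layout_done \<sigma>' \<and> reg \<sigma>' ''w'' = Suc w \<and>
    (\<exists>X. (small_cut w \<longrightarrow> min_cut w X) \<and>
      (\<forall>v. arr \<sigma>' ''sep'' v \<noteq> 0 \<longleftrightarrow> arr \<sigma> ''sep'' v \<noteq> 0 \<or> (\<exists>a\<in>window_cut w X. arc_label a = v))))"
    (is "runs _ _ _ ?Q")
proof -
  have after_flow: "runs (collect ;; incr ''w'') \<sigma>1 (1 + 100 * (M + 1) + 4) ?Q"
    if arcs: "window_arcs w \<sigma>1" and sep: "arr \<sigma>1 ''sep'' = arr \<sigma> ''sep''"
      and X: "small_cut w \<longrightarrow> min_cut w {x. arr \<sigma>1 ''mark'' x \<noteq> 0}" for \<sigma>1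
  proof -
    let ?X = "{x. arr \<sigma>1 ''mark'' x \<noteq> 0}"
    have rM: "reg \<sigma>1 ''M'' = M" using arcs by (simp add: window_arcs_def layout_done_def)
    have cut: "cut_arcs M (arr \<sigma>1 ''A'') (arr \<sigma>1 ''B'') ?X = window_cut w ?X"
      using arcs by (intro cut_arcs_cong) (simp add: window_arcs_def)
    have lab: "a \<in> window_cut w ?X \<Longrightarrow> arr \<sigma>1 ''lab'' a = arc_label a" for a
      using arcs by (simp add: window_arcs_def cut_arcs_def)
    show ?thesis
    proof (rule runs_Seq[OF runs_mono[OF collect_spec[OF rM, unfolded cut sep] le_refl]])
      fix \<sigma>2 assume *: "frame collect \<sigma>1 \<sigma>2 \<and> (\<forall>v. arr \<sigma>2 ''sep'' v \<noteq> 0 \<longleftrightarrow> arr \<sigma> ''sep'' v \<noteq> 0 \<or>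
        (\<exists>a\<in>window_cut w ?X. arr \<sigma>1 ''lab'' a = v))"
      then have arcs2: "window_arcs w \<sigma>2"
        by (intro window_arcs_frame[OF arcs, of collect]) (simp_all add: collect_def collect_body_def)
      let ?s = "lfsem (incr ''w'') \<sigma>2"
      have "layout_done ?s" "reg ?s ''w'' = Suc w" "arr ?s = arr \<sigma>2"
        using arcs2 by (simp_all add: window_arcs_def layout_done_def inputs_def)
      moreover have "\<forall>v. arr \<sigma>2 ''sep'' v \<noteq> 0 \<longleftrightarrow> arr \<sigma> ''sep'' v \<noteq> 0 \<or>
          (\<exists>a\<in>window_cut w ?X. arc_label a = v)"
        using * lab by (metis (no_types, lifting))
      ultimately show "runs (incr ''w'') \<sigma>2 4 ?Q" using X
        by (intro runs_loopfree) (simp_all only: loopfree.simps lfcost.simps acost.simps, auto)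
    qed
  qed
  have after_copy: "runs (max_flow ;; collect ;; incr ''w'') \<sigma>1
      (1 + (1000 * (M + NN + 1) * (NN + 2) + 10) + (1 + 100 * (M + 1) + 4)) ?Q"
    if arcs: "window_arcs w \<sigma>1" and sep: "arr \<sigma>1 ''sep'' = arr \<sigma> ''sep''"
      and copied: "\<forall>b<M. arr \<sigma>1 ''tl'' b = arc_tail w b \<and> arr \<sigma>1 ''hd'' b = arc_head w b" for \<sigma>1
  proof -
    have r: "reg \<sigma>1 ''S'' = s * L" "reg \<sigma>1 ''Z'' = z * L" "reg \<sigma>1 ''NN'' = NN" "reg \<sigma>1 ''M'' = M"
      using arcs by (simp_all add: window_arcs_def layout_done_def)
    have cut: "cut_arcs M (arr \<sigma>1 ''tl'') (arr \<sigma>1 ''hd'') A = window_cut w A" for A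
      using copied by (intro cut_arcs_cong) simp
    have less: "arcs_less NN M \<sigma>1" using copied arc_less by (simp add: arcs_less_def)
    show ?thesis
    proof (rule runs_Seq[OF runs_mono[OF max_flow_spec[OF r source_sink_less less, unfolded cut] le_refl]])
      fix \<sigma>2 assume *: "frame max_flow \<sigma>1 \<sigma>2 \<and> (let X = {x. arr \<sigma>2 ''mark'' x \<noteq> 0} in
        (\<exists>A. s * L \<in> A \<and> z * L \<notin> A \<and> card (window_cut w A) \<le> NN) \<longrightarrow>
        s * L \<in> X \<and> z * L \<notin> X \<and>
        (\<forall>A. s * L \<in> A \<and> z * L \<notin> A \<longrightarrow> card (window_cut w X) \<le> card (window_cut w A)))"
      show "runs (collect ;; incr ''w'') \<sigma>2 (1 + 100 * (M + 1) + 4) ?Q"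
      proof (rule after_flow)
        show "window_arcs w \<sigma>2"
          using * by (intro window_arcs_frame[OF arcs, of max_flow]) (simp_all add: max_flow_regs max_flow_arrs)
        show "arr \<sigma>2 ''sep'' = arr \<sigma> ''sep''"
          using * sep by (simp add: frame_def max_flow_arrs)
        show "small_cut w \<longrightarrow> min_cut w {x. arr \<sigma>2 ''mark'' x \<noteq> 0}"
          using * unfolding Let_def small_cut_def min_cut_def by blast
      qed
    qed
  qed
  have after_edges: "runs (copy_arcs ;; max_flow ;; collect ;; incr ''w'') \<sigma>1
      (1 + 100 * (M + 1) + (1 + (1000 * (M + NN + 1) * (NN + 2) + 10) + (1 + 100 * (M + 1) + 4))) ?Q"
    if arcs: "window_arcs w \<sigma>1" and sep: "arr \<sigma>1 ''sep'' = arr \<sigma> ''sep''" for \<sigma>1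
  proof -
    have rM: "reg \<sigma>1 ''M'' = M" using arcs by (simp add: window_arcs_def layout_done_def)
    show ?thesis
    proof (rule runs_Seq[OF runs_mono[OF copy_arcs_spec[OF rM] le_refl after_copy]], goal_cases)
      case (1 \<sigma>2)
      then show ?case by (intro window_arcs_frame[OF arcs, of copy_arcs])
        (simp_all add: copy_arcs_def copy_body_def)
    next
      case (2 \<sigma>2)
      then show ?case using sep by (simp add: frame_def copy_arcs_def copy_body_def)
    next
      case (3 \<sigma>2)
      then show ?case using arcs by (simp add: window_arcs_def)
    qed
  qed
  have "runs window \<sigma> (1 + 200 * (m + 1) + (1 + 100 * (M + 1) +
      (1 + (1000 * (M + NN + 1) * (NN + 2) + 10) + (1 + 100 * (M + 1) + 4)))) ?Q"
    unfolding window_def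
  proof (rule runs_Seq[OF runs_mono[OF edge_arcs_spec[OF laid w] le_refl after_edges]], goal_cases)
    case (1 \<sigma>1)
    then have "reg \<sigma>1 ''w'' = w" using w by (simp add: frame_def edge_arcs_def edges_body_def)
    moreover from 1 have "layout_done \<sigma>1"
      by (intro layout_done_frame[OF laid, of edge_arcs])
         (simp_all add: edge_arcs_def edges_body_def arc_tail_def arc_head_def arc_label_def M_def)
    ultimately show ?case using 1 by (simp add: window_arcs_def)
  next
    case (2 \<sigma>1)
    then show ?case by (simp add: frame_def edge_arcs_def edges_body_def)
  qed
  then show ?thesis
  proof (rule runs_mono)
    define D where "D = (M + NN + 1) * (NN + 2)"
    have "(M + NN + 1) * 2 \<le> D" unfolding D_def by (rule mult_le_mono2) simp
    moreover have "m \<le> M" by (simp add: M_def)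
    ultimately show "1 + 200 * (m + 1) + (1 + 100 * (M + 1) +
      (1 + (1000 * (M + NN + 1) * (NN + 2) + 10) + (1 + 100 * (M + 1) + 4))) \<le>
      2000 * (M + NN + 1) * (NN + 2)" 
      unfolding mult.assoc D_def[symmetric] by simp
  qed
qed

lemma all_windows_spec:
  assumes laid: "layout_done \<sigma>" and sep: "\<forall>v. arr \<sigma> ''sep'' v = 0"
  shows "runs all_windows \<sigma> (2100 * (M + NN + 1) * (NN + 2) * (tau + 1)) (\<lambda>\<sigma>'.
    \<exists>X. (\<forall>w\<in>{1..tau}. small_cut w \<longrightarrow> min_cut w (X w)) \<and>
      (\<forall>v. arr \<sigma>' ''sep'' v \<noteq> 0 \<longleftrightarrow> (\<exists>w\<in>{1..tau}. \<exists>a\<in>window_cut w (X w). arc_label a = v)))"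
proof -
  let ?init = "Assign ''w'' (N 1)" and ?b = "Neg (Less (R ''tau'') (R ''w''))"
  let ?I = "\<lambda>\<sigma>'. layout_done \<sigma>' \<and> 1 \<le> reg \<sigma>' ''w'' \<and> reg \<sigma>' ''w'' \<le> Suc tau \<and>
    (\<exists>X. (\<forall>w\<in>{1..<reg \<sigma>' ''w''}. small_cut w \<longrightarrow> min_cut w (X w)) \<and>
      (\<forall>v. arr \<sigma>' ''sep'' v \<noteq> 0 \<longleftrightarrow>
         (\<exists>w\<in>{1..<reg \<sigma>' ''w''}. \<exists>a\<in>window_cut w (X w). arc_label a = v)))"
  let ?phi = "\<lambda>\<sigma>'. Suc tau - reg \<sigma>' ''w''"
  let ?C = "2000 * (M + NN + 1) * (NN + 2)"
  have init: "?I (lfsem ?init \<sigma>)"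
    using laid sep by (simp add: layout_done_def inputs_def)
  have step: "runs window \<sigma>1 ?C (\<lambda>\<sigma>'. ?I \<sigma>' \<and> ?phi \<sigma>' < ?phi \<sigma>1)"
    if I: "?I \<sigma>1" and b: "bval ?b \<sigma>1" for \<sigma>1
  proof -
    define w where "w = reg \<sigma>1 ''w''"
    from I b have d: "layout_done \<sigma>1" and w: "1 \<le> w" "w \<le> tau"
      by (auto simp: w_def layout_done_def inputs_def)
    from I obtain X where X: "\<forall>w\<in>{1..<w}. small_cut w \<longrightarrow> min_cut w (X w)"
      "\<forall>v. arr \<sigma>1 ''sep'' v \<noteq> 0 \<longleftrightarrow> (\<exists>w\<in>{1..<w}. \<exists>a\<in>window_cut w (X w). arc_label a = v)"
      unfolding w_def by blast
    show ?thesis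
    proof (rule runs_mono[OF window_spec[OF d w_def[symmetric]] le_refl])
      fix \<sigma>2 assume new: "layout_done \<sigma>2 \<and> reg \<sigma>2 ''w'' = Suc w \<and> (\<exists>X. (small_cut w \<longrightarrow> min_cut w X) \<and>
        (\<forall>v. arr \<sigma>2 ''sep'' v \<noteq> 0 \<longleftrightarrow>
           arr \<sigma>1 ''sep'' v \<noteq> 0 \<or> (\<exists>a\<in>window_cut w X. arc_label a = v)))"
      then obtain Y where Y: "small_cut w \<longrightarrow> min_cut w Y" "\<forall>v. arr \<sigma>2 ''sep'' v \<noteq> 0 \<longleftrightarrow>
           arr \<sigma>1 ''sep'' v \<noteq> 0 \<or> (\<exists>a\<in>window_cut w Y. arc_label a = v)" by blast
      have *: "\<forall>w'\<in>{1..<Suc w}. small_cut w' \<longrightarrow> min_cut w' ((X(w := Y)) w')"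
        using X(1) Y(1) by (auto simp: less_Suc_eq)
      have **: "\<forall>v. arr \<sigma>2 ''sep'' v \<noteq> 0 \<longleftrightarrow>
        (\<exists>w'\<in>{1..<Suc w}. \<exists>a\<in>window_cut w' ((X(w := Y)) w'). arc_label a = v)"
      proof
        fix v
        have "{1..<Suc w} = insert w {1..<w}" using w by auto
        moreover have "(X(w := Y)) w' = X w'" if "w' \<in> {1..<w}" for w' using that by simp
        ultimately show "arr \<sigma>2 ''sep'' v \<noteq> 0 \<longleftrightarrow>
          (\<exists>w'\<in>{1..<Suc w}. \<exists>a\<in>window_cut w' ((X(w := Y)) w'). arc_label a = v)"
          unfolding Y(2)[rule_format] X(2)[rule_format] by auto
      qed
      have w2: "reg \<sigma>2 ''w'' = Suc w" and "layout_done \<sigma>2" using new by blast+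
      with * ** w show "?I \<sigma>2 \<and> ?phi \<sigma>2 < ?phi \<sigma>1"
        unfolding w2 w_def[symmetric] by (intro conjI exI[of _ "X(w := Y)"]) simp_all
    qed
  qed
  have "runs all_windows \<sigma> (1 + lfcost ?init + (?C + 50) * (tau + 1))
    (\<lambda>\<sigma>'. ?I \<sigma>' \<and> \<not> bval ?b \<sigma>' \<and> frame window (lfsem ?init \<sigma>) \<sigma>')"
    unfolding all_windows_def
    by (intro runs_Seq_loopfree runs_While[where I = ?I and C = ?C and \<phi> = ?phi] init step) simp_all
  then show ?thesis
  proof (rule runs_mono)
    let ?D = "(M + NN + 1) * (NN + 2)"
    have "1 * 2 \<le> ?D" by (intro mult_le_mono) simp_all
    then have "?C + 60 \<le> 2100 * ?D" unfolding mult.assoc by linarith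
    then have "(?C + 60) * (tau + 1) \<le> 2100 * ?D * (tau + 1)" by (rule mult_le_mono1)
    then show "1 + lfcost ?init + (?C + 50) * (tau + 1) \<le> 2100 * (M + NN + 1) * (NN + 2) * (tau + 1)"
      by (simp add: algebra_simps)
  next
    fix \<sigma>' assume *: "?I \<sigma>' \<and> \<not> bval ?b \<sigma>' \<and> frame window (lfsem ?init \<sigma>) \<sigma>'"
    then have "tau < reg \<sigma>' ''w''" "reg \<sigma>' ''w'' \<le> Suc tau" by (simp_all add: layout_done_def inputs_def)
    then have w: "reg \<sigma>' ''w'' = Suc tau" by simp
    from * obtain X where "\<forall>w\<in>{1..<Suc tau}. small_cut w \<longrightarrow> min_cut w (X w)"
      "\<forall>v. arr \<sigma>' ''sep'' v \<noteq> 0 \<longleftrightarrow> (\<exists>w\<in>{1..<Suc tau}. \<exists>a\<in>window_cut w (X w). arc_label a = v)"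
      unfolding w by blast
    then show "\<exists>X. (\<forall>w\<in>{1..tau}. small_cut w \<longrightarrow> min_cut w (X w)) \<and>
      (\<forall>v. arr \<sigma>' ''sep'' v \<noteq> 0 \<longleftrightarrow> (\<exists>w\<in>{1..tau}. \<exists>a\<in>window_cut w (X w). arc_label a = v))"
      unfolding atLeastLessThanSuc_atLeastAtMost by blast
  qed
qed

lemma separator_program_spec:
  assumes inp: "inputs \<sigma>" and sep: "\<forall>v. arr \<sigma> ''sep'' v = 0"
  shows "runs separator_program \<sigma> (100000 * ((m + n * tau) * n * tau ^ 2)) (\<lambda>\<sigma>'.
    \<exists>X. (\<forall>w\<in>{1..tau}. small_cut w \<longrightarrow> min_cut w (X w)) \<and>
      (\<forall>v. arr \<sigma>' ''sep'' v \<noteq> 0 \<longleftrightarrow> (\<exists>w\<in>{1..tau}. \<exists>a\<in>window_cut w (X w). arc_label a = v)))"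
    (is "runs _ _ _ ?Q")
proof -
  let ?T = "2100 * (M + NN + 1) * (NN + 2) * (tau + 1)"
  have body: "runs (layout ;; all_windows) \<sigma> (1 + 300 * (NN + 1) + ?T) ?Q"
  proof (rule runs_Seq[OF runs_mono[OF layout_spec[OF inp] le_refl all_windows_spec]], goal_cases)
    case (2 \<sigma>1)
    then show ?case using sep
      by (simp add: frame_def layout_def layout_init_def layout_body_def layout_final_def)
  qed blast
  have "runs separator_program \<sigma> (1 + bcost (Equal (R ''s'') (R ''z'')) + (1 + 300 * (NN + 1) + ?T)) ?Q"
    unfolding separator_program_def
    by (rule runs_Cond) (use inp s_neq_z body in \<open>simp_all add: inputs_def\<close>)
  then show ?thesis
  proof (rule runs_mono)
    \<comment> \<open>Additive terms are absorbed using \<open>1 \<le> a\<close>. The factors 5, 4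
      and 2 below multiply to 40, and 2100 * 40 = 84000 leaves room below 100000 for the layout and
      the first test.\<close>
    define a where "a = n * tau"
    have a: "1 \<le> a" using s_less tau_pos by (simp add: a_def)
    have NN: "NN = 2 * a" by (simp add: NN_def L_def a_def)
    have "M + NN + 1 \<le> 5 * (m + a)" using a by (simp add: M_def NN)
    moreover have "NN + 2 \<le> 4 * a" using a by (simp add: NN)
    ultimately have 1: "(M + NN + 1) * (NN + 2) \<le> 5 * (m + a) * (4 * a)" by (rule mult_le_mono)
    have "tau + 1 \<le> 2 * tau" using tau_pos by simp
    from mult_le_mono[OF 1 this]
    have "(M + NN + 1) * (NN + 2) * (tau + 1) \<le> 40 * ((m + a) * a * tau)" by (simp add: algebra_simps)
    moreover have "1 * a * 1 \<le> (m + a) * a * tau" using a tau_pos by (intro mult_le_mono) simp_all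
    moreover have "(m + n * tau) * n * tau ^ 2 = (m + a) * a * tau"
      by (simp add: a_def power2_eq_square algebra_simps)
    ultimately show "1 + bcost (Equal (R ''s'') (R ''z'')) + (1 + 300 * (NN + 1) + ?T) \<le>
      100000 * ((m + n * tau) * n * tau ^ 2)"
      using a unfolding NN mult.assoc by simp
  qed
qed

end

section \<open>Separators and cuts\<close>

locale presented_graph =
  fixes G :: "'v temporal_graph" and s z :: 'v and t :: nat
    and num :: "'v \<Rightarrow> nat" and es :: "('v \<times> 'v \<times> nat) list"
  assumes graph: "temporal_graph G" and s_vert: "s \<in> verts G" and z_vert: "z \<in> verts G"
    and t_pos: "1 \<le> t" and numbering: "vertex_numbering G num" and listing: "edge_listing G es"
    and distinct_ends: "s \<noteq> z"
begin

lemma edge_sel [simp]: "edge_src (u, v, i) = u" "edge_tgt (u, v, i) = v" "edge_time (u, v, i) = i"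
  by (simp_all add: edge_src_def edge_tgt_def edge_time_def)

lemma num_less: "v \<in> verts G \<Longrightarrow> num v < card (verts G)"
  and num_eq_iff: "u \<in> verts G \<Longrightarrow> v \<in> verts G \<Longrightarrow> num u = num v \<longleftrightarrow> u = v"
  using numbering unfolding vertex_numbering_def bij_betw_def inj_on_def by auto

lemma edgeD: "(u, v, i) \<in> edges G \<Longrightarrow> u \<in> verts G \<and> v \<in> verts G \<and> 1 \<le> i \<and> i \<le> lifetime G \<and> u \<noteq> v"
  using graph unfolding temporal_graph_def by auto

lemma listed_edge:
  assumes "e < length es"
  obtains u v i where "es ! e = (u, v, i)" "(u, v, i) \<in> edges G"
  using assms listing unfolding edge_listing_def by (metis nth_mem prod_cases3)

end

sublocale presented_graph \<subseteq> network "card (verts G)" "length es" "lifetime G" "num s" "num z" t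
  "\<lambda>e. num (edge_src (es ! e))" "\<lambda>e. num (edge_tgt (es ! e))" "\<lambda>e. edge_time (es ! e)"
proof unfold_locales
  show "num s < card (verts G)" "num z < card (verts G)" "num s \<noteq> num z"
    using num_less num_eq_iff s_vert z_vert distinct_ends by auto
  show "1 \<le> lifetime G" using graph by (simp add: temporal_graph_def)
  fix e assume "e < length es"
  then obtain u v i where "es ! e = (u, v, i)" "(u, v, i) \<in> edges G" by (rule listed_edge)
  with edgeD[of u v i] num_less
  show "num (edge_src (es ! e)) < card (verts G)" "num (edge_tgt (es ! e)) < card (verts G)"
    "1 \<le> edge_time (es ! e)" "edge_time (es ! e) \<le> lifetime G"
    by auto
qed

section \<open>The cut induced by a separator\<close>

context presented_graph
begin

abbreviation "\<tau> \<equiv> lifetime G"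

text \<open>The end vertex may lie in \<open>S\<close>: the entry of a vertex of \<open>S\<close>
  can be reached, only its exit is blocked. The bound \<open>i\<close> on the labels is an upper
  bound rather than the arrival time, so waiting is built in.\<close>

definition reaches :: "'v set \<Rightarrow> nat \<Rightarrow> 'v \<Rightarrow> nat \<Rightarrow> bool" where
  "reaches S w v i \<longleftrightarrow> (\<exists>p. temporal_path G s v p \<and>
     (\<forall>e\<in>set p. w \<le> edge_time e \<and> edge_time e < w + t \<and> edge_time e \<le> i) \<and>
     S \<inter> (set (path_verts p) - {v}) = {})"

lemma reaches_mono: "reaches S w v i \<Longrightarrow> i \<le> i' \<Longrightarrow> reaches S w v i'"
  unfolding reaches_def by fastforce

lemma edge_path: "(s, v, i) \<in> edges G \<Longrightarrow> temporal_path G s v [(s, v, i)]"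
  using edgeD[of s v i] by (auto simp: temporal_path_def path_verts_def)

lemma reaches_edge:
  assumes "(s, v, i) \<in> edges G" "w \<le> i" "i < w + t" "s \<notin> S"
  shows "reaches S w v i"
  unfolding reaches_def
  using assms edge_path[OF assms(1)]
  by (intro exI[of _ "[(s, v, i)]"]) (auto simp: path_verts_def)

lemma temporal_path_append:
  assumes "temporal_path G a u p" "(u, v, i) \<in> edges G" "\<forall>e\<in>set p. edge_time e \<le> i"
    "v \<notin> set (path_verts p)"
  shows "temporal_path G a v (p @ [(u, v, i)])"
proof -
  let ?p = "p @ [(u, v, i)]"
  from assms(1) have p: "p \<noteq> []" "edge_tgt (last p) = u"
    "\<And>k. Suc k < length p \<Longrightarrow> edge_tgt (p ! k) = edge_src (p ! Suc k)"
    by (auto simp: temporal_path_def)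
  have "edge_tgt (?p ! k) = edge_src (?p ! Suc k)" if "Suc k < length ?p" for k
  proof (cases "Suc k < length p")
    case True
    then show ?thesis using p(3) by (simp add: nth_append)
  next
    case False
    with that have "length p = Suc k" by simp
    then show ?thesis using p(1,2) by (simp add: nth_append last_conv_nth)
  qed
  moreover have "path_verts ?p = path_verts p @ [v]"
    using p(1) by (simp add: path_verts_def)
  ultimately show ?thesis
    using assms p(1) unfolding temporal_path_def
    by (auto simp: sorted_append)
qed

lemma temporal_path_take:
  assumes p: "temporal_path G a b p" and k: "k < length p"
  shows "temporal_path G a (edge_tgt (p ! k)) (take (Suc k) p)"
    and "set (path_verts (take (Suc k) p)) \<subseteq> set (path_verts p)"
proof -
  have eq: "path_verts (take (Suc k) p) = take (Suc (Suc k)) (path_verts p)"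
    using p k by (cases p) (auto simp: path_verts_def temporal_path_def take_map)
  then show "set (path_verts (take (Suc k) p)) \<subseteq> set (path_verts p)"
    by (simp add: set_take_subset del: take_Suc_Cons)
  have "sorted (map edge_time (take (Suc k) p))" "set (take (Suc k) p) \<subseteq> set p"
    using p by (auto simp: temporal_path_def take_map[symmetric] sorted_wrt_take intro: set_take_subset[THEN subsetD])
  moreover have "hd (take (Suc k) p) = hd p" "last (take (Suc k) p) = p ! k" "take (Suc k) p \<noteq> []"
    using k by (auto simp: take_Suc_conv_app_nth hd_append hd_conv_nth)
  moreover have "distinct (path_verts (take (Suc k) p))"
    using p unfolding eq temporal_path_def by (simp del: take_Suc_Cons)
  moreover have "edge_tgt (take (Suc k) p ! i) = edge_src (take (Suc k) p ! Suc i)"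
    if "Suc i < length (take (Suc k) p)" for i
    using p that by (simp add: temporal_path_def)
  ultimately show "temporal_path G a (edge_tgt (p ! k)) (take (Suc k) p)"
    using p unfolding temporal_path_def by auto
qed

text \<open>If the new edge returns to a vertex of the path, the path is cut off there instead.\<close>

lemma reaches_step:
  assumes u: "reaches S w u i" "u \<notin> S" and e: "(u, v, i) \<in> edges G" "w \<le> i" "i < w + t" and "v \<noteq> s"
  shows "reaches S w v i"
proof -
  from u obtain p where p: "temporal_path G s u p"
    "\<forall>e\<in>set p. w \<le> edge_time e \<and> edge_time e < w + t \<and> edge_time e \<le> i"
    "S \<inter> set (path_verts p) = {}" unfolding reaches_def by blast
  show ?thesis
  proof (cases "v \<in> set (path_verts p)")
    case False
    with temporal_path_append[OF p(1) e(1)] p(2)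
    have "temporal_path G s v (p @ [(u, v, i)])" by blast
    moreover have "set (path_verts (p @ [(u, v, i)])) = insert v (set (path_verts p))"
      using p(1) by (auto simp: path_verts_def temporal_path_def)
    ultimately show ?thesis
      unfolding reaches_def using p(2,3) e
      by (intro exI[of _ "p @ [(u, v, i)]"]) auto
  next
    case True
    with p(1) \<open>v \<noteq> s\<close> have "v \<in> edge_tgt ` set p"
      by (auto simp: path_verts_def temporal_path_def)
    then obtain k where k: "k < length p" "v = edge_tgt (p ! k)" by (auto simp: in_set_conv_nth)
    from temporal_path_take[OF p(1) k(1)] p(2,3) k(2) show ?thesis
      unfolding reaches_def
      by (intro exI[of _ "take (Suc k) p"]) (auto dest: in_set_takeD)
  qed
qed

text \<open>Labels in \<open>{w..<w + t}\<close> give travelling time at most \<open>t\<close>. A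
  separator does not contain \<open>z\<close>, so the exemption of the end vertex in
  \<open>reaches\<close> is harmless.\<close>

lemma reaches_sink_not_separator:
  assumes "reaches S w z i"
  shows "\<not> temporal_separator G s z t S"
proof
  assume S: "temporal_separator G s z t S"
  from assms obtain p where p: "temporal_path G s z p"
    "\<forall>e\<in>set p. w \<le> edge_time e \<and> edge_time e < w + t"
    "S \<inter> (set (path_verts p) - {z}) = {}" unfolding reaches_def by blast
  have "hd p \<in> set p" "last p \<in> set p" using p(1) by (auto simp: temporal_path_def)
  with p(2) have "w \<le> edge_time (hd p)" "edge_time (last p) < w + t" by auto
  then have "travelling_time p \<le> t" using t_pos unfolding travelling_time_def by arith
  with S p show False unfolding temporal_separator_def by blast
qed

text \<open>\<open>j div 2 + 1\<close> is the time of node \<open>j\<close> in a chain, and odd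
  \<open>j\<close> are exits. Vertices of \<open>S\<close> keep their reached entries but lose all
  exits, so that exactly arcs from an entry to an exit of such a vertex can cross.\<close>

definition reached_nodes :: "'v set \<Rightarrow> nat \<Rightarrow> nat set" where
  "reached_nodes S w = insert (num s * L) {num v * L + j |v j. v \<in> verts G - {s, z} \<and> j < L \<and>
     reaches S w v (j div 2 + 1) \<and> (odd j \<longrightarrow> v \<notin> S)}"

lemma node_in_reached:
  assumes "v \<in> verts G" "v \<noteq> s" "j < L"
  shows "num v * L + j \<in> reached_nodes S w \<longleftrightarrow>
    v \<noteq> z \<and> reaches S w v (j div 2 + 1) \<and> (odd j \<longrightarrow> v \<notin> S)" (is "?l \<longleftrightarrow> ?r")
proof
  assume ?r
  then show ?l using assms unfolding reached_nodes_def by blast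
next
  assume ?l
  then consider "num v * L + j = num s * L" | u k where "num v * L + j = num u * L + k"
    "u \<in> verts G - {s, z}" "k < L" "reaches S w u (k div 2 + 1)" "odd k \<longrightarrow> u \<notin> S"
    unfolding reached_nodes_def by blast
  then show ?r
  proof cases
    case 1
    then have "num v = num s" using node_div[OF assms(3), of "num v"] L_pos by simp
    with assms s_vert show ?thesis by (simp add: num_eq_iff)
  next
    case 2
    from arg_cong[OF 2(1), of "\<lambda>x. x div L"] have "num v = num u"
      unfolding node_div[OF assms(3)] node_div[OF 2(3)] .
    moreover from arg_cong[OF 2(1), of "\<lambda>x. x mod L"] have "j = k"
      unfolding node_mod[OF assms(3)] node_mod[OF 2(3)] .
    moreover have "v = u" using calculation(1) 2(2) assms(1) by (simp add: num_eq_iff)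
    ultimately show ?thesis using 2 by simp
  qed
qed

lemma source_reached: "num s * L \<in> reached_nodes S w"
  by (simp add: reached_nodes_def)

lemma sink_not_reached: "num z * L \<notin> reached_nodes S w"
  using node_in_reached[OF z_vert distinct_ends[symmetric], of 0] L_pos by simp

text \<open>Reachability is monotone in time, so a chain arc can only cross where an exit of a
  vertex of \<open>S\<close> is missing; such an arc has an even position in its chain. No edge arc
  crosses, as a temporal path reaching its tail extends to its head.\<close>

lemma cut_of_separator:
  assumes S: "temporal_separator G s z t S"
  shows "window_cut w (reached_nodes S w) \<subseteq> (\<lambda>(v, i). num v * L + 2 * i) ` (S \<times> {..<\<tau>})"
proof
  fix a assume "a \<in> window_cut w (reached_nodes S w)"
  then have a: "a < M" and tail: "arc_tail w a \<in> reached_nodes S w"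
    and head: "arc_head w a \<notin> reached_nodes S w" by (auto simp: cut_arcs_def)
  have SV: "S \<subseteq> verts G - {s, z}" using S by (simp add: temporal_separator_def)
  show "a \<in> (\<lambda>(v, i). num v * L + 2 * i) ` (S \<times> {..<\<tau>})"
  proof (cases "a < NN")
    case True
    then have ta: "a \<in> reached_nodes S w" and "chain_head a \<noteq> a"
      using tail head by (auto simp: arc_tail_def arc_head_def)
    then have chain: "a div L \<noteq> num s" "Suc (a mod L) < L" "chain_head a = Suc a"
      by (auto simp: chain_head_def split: if_splits)
    have "a \<noteq> num s * L" using chain(1) L_pos by auto
    with ta obtain v j where v: "a = num v * L + j" "v \<in> verts G - {s, z}" "j < L"
      "reaches S w v (j div 2 + 1)" unfolding reached_nodes_def by blast
    have j: "Suc j < L" using chain(2) v(1,3) by simp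
    have "num v * L + Suc j \<notin> reached_nodes S w"
      using head True chain(3) v(1) by (simp add: arc_head_def)
    moreover have "reaches S w v (Suc j div 2 + 1)"
      using v(4) by (rule reaches_mono) (simp add: div_le_mono)
    ultimately have "v \<in> S" "even j" using v(2) j node_in_reached[of v "Suc j"] by auto
    moreover from this j have "j div 2 < \<tau>" by (simp add: L_def)
    ultimately show ?thesis
      using v(1) by (intro image_eqI[of _ _ "(v, j div 2)"]) auto
  next
    case False
    define e where "e = a - NN"
    have e: "e < length es" using False a by (simp add: e_def M_def)
    then obtain u v i where uvi: "es ! e = (u, v, i)" "(u, v, i) \<in> edges G" by (rule listed_edge)
    note uv = edgeD[OF uvi(2)]
    have tail': "edge_tail w e \<in> reached_nodes S w" and head': "edge_head w e \<notin> reached_nodes S w"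
      using tail head False by (simp_all add: arc_tail_def arc_head_def e_def)
    have live: "live w e"
    proof (rule ccontr)
      assume "\<not> live w e"
      with tail' head' show False by (simp add: edge_tail_def edge_head_def)
    qed
    then have time: "w \<le> i" "i < w + t" and "v \<noteq> s"
      by (auto simp: live_def uvi)
    have "reaches S w v i"
    proof (cases "u = s")
      case True
      then show ?thesis using uvi(2) time SV by (auto intro: reaches_edge)
    next
      case False
      then have "num u \<noteq> num s" using uv s_vert by (simp add: num_eq_iff)
      define j where "j = 2 * i - 1"
      have j: "j div 2 + 1 = i" "odd j" using uv unfolding j_def by (cases i; simp)+
      have "edge_tail w e = num u * L + j"
        using edge_tail_eq[OF e live] \<open>num u \<noteq> num s\<close> by (simp add: uvi j_def)
      moreover have "j < L" using exit_less[OF e] by (simp add: uvi j_def)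
      ultimately have "reaches S w u i" "u \<notin> S"
        using tail' False uv node_in_reached[of u j] j by auto
      then show ?thesis using reaches_step[OF _ _ uvi(2) time \<open>v \<noteq> s\<close>] by blast
    qed
    \<comment> \<open>The separator property enters here: reaching \<open>z\<close> would yield a
      short path that avoids \<open>S\<close>.\<close>
    then have "v \<noteq> z" using S reaches_sink_not_separator by blast
    then have "num v \<noteq> num z" using uv z_vert by (simp add: num_eq_iff)
    define j where "j = 2 * i - 2"
    have j: "j div 2 + 1 = i" "even j" using uv unfolding j_def by (cases i; simp)+
    have "edge_head w e = num v * L + j"
      using edge_head_eq[OF e live] \<open>num v \<noteq> num z\<close> by (simp add: uvi j_def)
    moreover have "j < L" using entry_less[OF e] by (simp add: uvi j_def)
    ultimately have "edge_head w e \<in> reached_nodes S w"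
      using uv \<open>v \<noteq> s\<close> \<open>v \<noteq> z\<close> \<open>reaches S w v i\<close> node_in_reached[of v j] j by auto
    with head' show ?thesis by blast
  qed
qed

lemma card_cut_of_separator:
  assumes "temporal_separator G s z t S"
  shows "card (window_cut w (reached_nodes S w)) \<le> card S * \<tau>"
proof -
  have "finite S" using assms graph
    unfolding temporal_separator_def temporal_graph_def by (meson Diff_subset finite_subset)
  then have "card (window_cut w (reached_nodes S w)) \<le> card (S \<times> {..<\<tau>})"
    by (intro surj_card_le[OF _ cut_of_separator[OF assms]]) simp
  then show ?thesis by (simp add: card_cartesian_product)
qed

text \<open>A separator has at most as many elements as there are vertices, and \<open>NN\<close> is
  twice the number of vertices times \<open>\<tau>\<close>. Hence the round counter suffices
  whenever a separator exists.\<close>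

lemma small_cut_of_separator:
  assumes "temporal_separator G s z t S"
  shows "small_cut w"
proof -
  have "card S \<le> card (verts G)"
    using assms graph unfolding temporal_separator_def temporal_graph_def by (intro card_mono) auto
  then have "card S * \<tau> \<le> card (verts G) * (2 * \<tau>)" by (intro mult_le_mono) simp_all
  with card_cut_of_separator[OF assms, of w] have "card (window_cut w (reached_nodes S w)) \<le> NN"
    unfolding NN_def L_def by (rule order_trans)
  then show ?thesis
    unfolding small_cut_def
    by (intro exI[of _ "reached_nodes S w"] conjI source_reached sink_not_reached)
qed

section \<open>From minimum cuts back to a separator\<close>

definition cut_verts :: "(nat \<Rightarrow> nat set) \<Rightarrow> 'v set" where
  "cut_verts X = {v \<in> verts G. \<exists>w\<in>{1..\<tau>}. \<exists>a\<in>window_cut w (X w). arc_label a = num v}"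

lemma cut_vertsI:
  "w \<in> {1..\<tau>} \<Longrightarrow> a \<in> window_cut w (X w) \<Longrightarrow> arc_label a = num v \<Longrightarrow> v \<in> verts G \<Longrightarrow> v \<in> cut_verts X"
  unfolding cut_verts_def by blast

lemma min_cutD:
  assumes "min_cut w Y" "num s * L \<in> A" "num z * L \<notin> A"
  shows "card (window_cut w Y) \<le> card (window_cut w A)"
  using assms(1)[unfolded min_cut_def, THEN conjunct2, THEN conjunct2, rule_format, of A] assms(2,3)
  by simp

text \<open>The sets \<open>X w\<close> do not depend on \<open>S\<close>, so the bound holds for
  all separators at once and in particular for a smallest one.\<close>

lemma card_cut_verts:
  assumes "\<And>w. w \<in> {1..\<tau>} \<Longrightarrow> min_cut w (X w)" and S: "temporal_separator G s z t S"
  shows "card (cut_verts X) \<le> \<tau> ^ 2 * card S"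
proof -
  let ?W = "\<Union>w\<in>{1..\<tau>}. arc_label ` window_cut w (X w)"
  have "inj_on num (cut_verts X)" by (rule inj_onI) (simp add: cut_verts_def num_eq_iff)
  then have "card (cut_verts X) = card (num ` cut_verts X)" by (simp add: card_image)
  also have "\<dots> \<le> card ?W"
  proof (rule card_mono)
    show "num ` cut_verts X \<subseteq> ?W"
    proof
      fix y assume "y \<in> num ` cut_verts X"
      then obtain w a where w: "w \<in> {1..\<tau>}" and a: "a \<in> window_cut w (X w)" and y: "arc_label a = y"
        unfolding cut_verts_def by blast
      from imageI[OF a, of arc_label] show "y \<in> ?W" unfolding y using w by (rule UN_I[rotated])
    qed
  qed (simp add: finite_cut_arcs)
  also have "\<dots> \<le> (\<Sum>w\<in>{1..\<tau>}. card (arc_label ` window_cut w (X w)))" by (rule card_UN_le) simp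
  also have "\<dots> \<le> (\<Sum>w\<in>{1..\<tau>}. card S * \<tau>)"
  proof (rule sum_mono)
    fix w assume "w \<in> {1..\<tau>}"
    have "card (arc_label ` window_cut w (X w)) \<le> card (window_cut w (X w))"
      by (rule card_image_le[OF finite_cut_arcs])
    also have "\<dots> \<le> card (window_cut w (reached_nodes S w))"
      by (intro min_cutD[OF assms(1)] source_reached sink_not_reached) fact
    also have "\<dots> \<le> card S * \<tau>" by (rule card_cut_of_separator[OF S])
    finally show "card (arc_label ` window_cut w (X w)) \<le> card S * \<tau>" .
  qed
  also have "\<dots> = \<tau> ^ 2 * card S" by (simp add: power2_eq_square)
  finally show ?thesis .
qed

text \<open>The path consisting of this edge has travelling time \<open>1\<close> and no inner
  vertex that could be deleted.\<close>

lemma no_direct_edge: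
  assumes "temporal_separator G s z t S"
  shows "(s, z, i) \<notin> edges G"
proof
  assume "(s, z, i) \<in> edges G"
  note p = edge_path[OF this]
  have "travelling_time [(s, z, i)] \<le> t" using t_pos by (simp add: travelling_time_def)
  with p assms have "S \<inter> set (path_verts [(s, z, i)]) \<noteq> {}" "S \<subseteq> verts G - {s, z}"
    unfolding temporal_separator_def by blast+
  then show False by (auto simp: path_verts_def)
qed

text \<open>A crossing arc is not a loop. This excludes the chains of \<open>s\<close> and
  \<open>z\<close> and all arcs that are not live; a live arc gets the label \<open>s\<close> or
  \<open>z\<close> only if it joins \<open>s\<close> to \<open>z\<close> directly.\<close>

lemma cut_verts_inner:
  assumes S: "temporal_separator G s z t S"
  shows "cut_verts X \<subseteq> verts G - {s, z}"
proof
  fix x assume "x \<in> cut_verts X"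
  then obtain w a where x: "x \<in> verts G" and a: "a \<in> window_cut w (X w)" "arc_label a = num x"
    unfolding cut_verts_def by blast
  from a(1) have aM: "a < M" and neq: "arc_tail w a \<noteq> arc_head w a" by (auto simp: cut_arcs_def)
  have "num x \<noteq> num s \<and> num x \<noteq> num z"
  proof (cases "a < NN")
    case True
    with a(2) neq show ?thesis
      by (auto simp: arc_label_def arc_tail_def arc_head_def chain_head_def split: if_splits)
  next
    case False
    define e where "e = a - NN"
    have e: "e < length es" using False aM by (simp add: e_def M_def)
    then obtain u v i where uvi: "es ! e = (u, v, i)" "(u, v, i) \<in> edges G" by (rule listed_edge)
    have "live w e"
    proof (rule ccontr)
      assume "\<not> live w e"
      with neq False show False
        by (simp add: arc_tail_def arc_head_def e_def edge_tail_def edge_head_def)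
    qed
    moreover have "\<not> (u = s \<and> v = z)" using no_direct_edge[OF S] uvi(2) by auto
    ultimately show ?thesis
      using a(2) False edgeD[OF uvi(2)] s_vert z_vert
      by (auto simp: arc_label_def e_def[symmetric] live_def uvi num_eq_iff
          split: if_splits)
  qed
  with x show "x \<in> verts G - {s, z}" by auto
qed

text \<open>The first chain arc of \<open>v\<close> to leave \<open>X w\<close> would be labelled
  \<open>v\<close> and put it into \<open>cut_verts X\<close>. So waiting at a remaining vertex
  never leaves the source side.\<close>

lemma stays_inside:
  assumes w: "w \<in> {1..\<tau>}" and v: "v \<in> verts G" "v \<noteq> s" "v \<noteq> z" "v \<notin> cut_verts X"
    and "num v * L + j \<in> X w" "j \<le> j'" "j' < L"
  shows "num v * L + j' \<in> X w"
  using assms(7,8,6)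
proof (induction j' rule: dec_induct)
  case (step k)
  let ?q = "num v * L + k"
  have q: "?q < NN" "?q < M" using node_less[OF num_less[OF v(1)], of k] step.prems by (simp_all add: M_def)
  have "chain_head ?q = Suc ?q"
    using node_div[of k "num v"] node_mod[of k "num v"] step.prems v s_vert z_vert
    by (simp add: chain_head_def num_eq_iff)
  moreover have "?q \<in> X w" using step by simp
  ultimately have "Suc ?q \<in> X w"
    using q v cut_vertsI[OF w, of ?q X v] node_div[of k "num v"] step.prems
    by (auto simp: cut_arcs_def arc_tail_def arc_head_def arc_label_def)
  then show ?case by simp
qed simp

text \<open>A crossing arc would be labelled with one of its endpoints, contrary to both of them
  remaining.\<close>

lemma edge_stays_inside:
  assumes w: "w \<in> {1..\<tau>}" and e: "e < length es" "es ! e = (u, v, i)"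
    and uv: "u \<in> verts G" "v \<in> verts G" "u \<notin> cut_verts X" "v \<notin> cut_verts X"
    and tail: "edge_tail w e \<in> X w"
  shows "edge_head w e \<in> X w"
proof (rule ccontr)
  assume "edge_head w e \<notin> X w"
  with tail e(1) have "NN + e \<in> window_cut w (X w)"
    by (simp add: cut_arcs_def arc_tail_def arc_head_def M_def)
  moreover have "arc_label (NN + e) = num u \<or> arc_label (NN + e) = num v"
    by (simp add: arc_label_def e)
  ultimately show False using uv cut_vertsI[OF w] by metis
qed

text \<open>A short path that avoids \<open>cut_verts X\<close> is followed in the network of the
  window starting at its first label. It begins in \<open>X w\<close> and by
  \<open>stays_inside\<close> and \<open>edge_stays_inside\<close> never leaves it, yet it ends at
  the sink, which is outside.\<close>

lemma cut_verts_separator: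
  assumes X: "\<And>w. w \<in> {1..\<tau>} \<Longrightarrow> min_cut w (X w)" and S: "temporal_separator G s z t S"
  shows "temporal_separator G s z t (cut_verts X)"
  unfolding temporal_separator_def
proof (intro conjI allI impI cut_verts_inner[OF S])
  fix p assume p: "temporal_path G s z p \<and> travelling_time p \<le> t"
  show "cut_verts X \<inter> set (path_verts p) \<noteq> {}"
  proof
    assume avoid: "cut_verts X \<inter> set (path_verts p) = {}"
    define w where "w = edge_time (hd p)"
    from p have ne: "p \<noteq> []" and sub: "set p \<subseteq> edges G" and hd: "edge_src (hd p) = s"
      and last: "edge_tgt (last p) = z"
      and chain: "\<And>k. Suc k < length p \<Longrightarrow> edge_tgt (p ! k) = edge_src (p ! Suc k)"
      and dist: "distinct (s # map edge_tgt p)" and sorted: "sorted (map edge_time p)"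
      by (auto simp: temporal_path_def path_verts_def)
    have pv: "path_verts p = s # map edge_tgt p" using hd by (simp add: path_verts_def)
    have tgt: "edge_tgt (p ! k) \<in> set (path_verts p)" if "k < length p" for k
      using that by (simp add: pv)
    have src: "edge_src (p ! k) \<in> set (path_verts p)" if "k < length p" for k
      using that chain[of "k - 1"] hd ne tgt[of "k - 1"] by (cases k) (auto simp: pv hd_conv_nth)
    have tgt_eq: "edge_tgt (p ! k) = edge_tgt (p ! l) \<longleftrightarrow> k = l" if "k < length p" "l < length p" for k l
      using dist that by (auto simp: distinct_map inj_on_eq_iff nth_eq_iff_index_eq)
    have last_k: "edge_tgt (p ! k) = z \<longleftrightarrow> Suc k = length p" if "k < length p" for k
      using tgt_eq[OF that, of "length p - 1"] last ne that by (auto simp: last_conv_nth)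
    have "hd p \<in> edges G" using ne sub by auto
    moreover obtain u v i where "hd p = (u, v, i)" by (metis prod_cases3)
    ultimately have w: "w \<in> {1..\<tau>}" using edgeD[of u v i] by (simp add: w_def)
    have live: "live w e" and edge: "(u, v, i) \<in> edges G"
      if k: "k < length p" and e: "e < length es" "es ! e = p ! k" "p ! k = (u, v, i)" for k e u v i
    proof -
      show edge: "(u, v, i) \<in> edges G" using nth_mem[OF k] e(3) sub by auto
      have "w \<le> i" "i \<le> edge_time (last p)"
        using sorted_nth_mono[OF sorted, of 0 k] sorted_nth_mono[OF sorted, of k "length p - 1"] k ne e(3)
        by (simp_all add: w_def hd_conv_nth last_conv_nth)
      moreover have "edge_time (last p) - w + 1 \<le> t"
        using p by (simp add: travelling_time_def w_def)
      then have "edge_time (last p) < w + t" by arith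
      moreover have "edge_tgt (p ! k) \<in> edge_tgt ` set p" using k by simp
      then have "v \<noteq> s" using dist e(3) by auto
      moreover have "u \<noteq> z"
      proof (cases k)
        case 0
        then show ?thesis using hd ne e(3) distinct_ends by (simp add: hd_conv_nth)
      next
        case (Suc l)
        then show ?thesis using chain[of l] last_k[of l] k e(3) by auto
      qed
      ultimately show "live w e"
        using edgeD[OF edge] s_vert z_vert
        by (simp add: live_def e num_eq_iff)
    qed
    \<comment> \<open>Induction along the path. Only heads of arcs are tracked; the tail of the next
      arc is reached from the preceding head by waiting.\<close>
    have inside: "edge_head w e \<in> X w" if "k < length p" "e < length es" "es ! e = p ! k" for k e
      using that
    proof (induction k arbitrary: e)
      case 0
      obtain u v i where uvi: "p ! 0 = (u, v, i)" by (metis prod_cases3)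
      note live = live[OF 0 uvi] and edge = edge[OF 0 uvi]
      have "u = s" using hd ne uvi by (simp add: hd_conv_nth)
      then have "edge_tail w e = num s * L" using live by (simp add: edge_tail_def 0 uvi)
      then have "edge_tail w e \<in> X w" using X[OF w] by (simp add: min_cut_def)
      moreover have "u \<notin> cut_verts X" "v \<notin> cut_verts X"
        using src[of 0] tgt[of 0] avoid 0 uvi by auto
      moreover have es: "es ! e = (u, v, i)" using 0(3) uvi by simp
      ultimately show ?case
        using edgeD[OF edge] by (intro edge_stays_inside[OF w 0(2) es]) auto
    next
      case (Suc k)
      obtain u v i where uvi: "p ! Suc k = (u, v, i)" by (metis prod_cases3)
      obtain u' v' i' where uvi': "p ! k = (u', v', i')" by (metis prod_cases3)
      have "v' = u" using chain[of k] Suc.prems(1) uvi uvi' by simp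
      have "p ! k \<in> set es" using Suc.prems(1) sub listing by (auto simp: edge_listing_def)
      then obtain e' where e': "e' < length es" "es ! e' = p ! k" by (metis in_set_conv_nth)
      have k: "k < length p" using Suc.prems by simp
      note live = live[OF Suc.prems uvi] and edge = edge[OF Suc.prems uvi]
        and live' = live[OF k e' uvi'] and edge' = edge[OF k e' uvi']
      have avoid_uv: "u \<notin> cut_verts X" "v \<notin> cut_verts X"
        using src[of "Suc k"] tgt[of "Suc k"] avoid Suc.prems(1) uvi
        by auto
      have us: "u \<noteq> s" and uz: "u \<noteq> z"
        using live live' e'(2) Suc.prems(3) uvi uvi' \<open>v' = u\<close>
        by (auto simp: live_def)
      have nus: "num u \<noteq> num s" "num u \<noteq> num z"
        using us uz edgeD[OF edge] s_vert z_vert by (simp_all add: num_eq_iff)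
      have "i' \<le> i"
        using sorted_nth_mono[OF sorted, of k "Suc k"] Suc.prems(1) uvi uvi' by simp
      have "edge_head w e' = num u * L + (2 * i' - 2)"
        using edge_head_eq[OF e'(1) live'] nus by (simp add: e' uvi' \<open>v' = u\<close>)
      with Suc.IH[OF k e'] have "num u * L + (2 * i' - 2) \<in> X w" by simp
      \<comment> \<open>The entry at the arrival time lies below the exit at the departure time,
        also if both times agree: labels need not increase strictly.\<close>
      moreover have "2 * i' - 2 \<le> 2 * i - 1" using \<open>i' \<le> i\<close> by linarith
      moreover have "2 * i - 1 < L" using exit_less[OF Suc.prems(2)] by (simp add: Suc.prems uvi)
      ultimately have "num u * L + (2 * i - 1) \<in> X w"
        using stays_inside[OF w _ us uz avoid_uv(1)] edgeD[OF edge] by blast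
      moreover have "edge_tail w e = num u * L + (2 * i - 1)"
        using edge_tail_eq[OF Suc.prems(2) live] nus by (simp add: Suc.prems uvi)
      moreover have es: "es ! e = (u, v, i)" using Suc.prems(3) uvi by simp
      ultimately show ?case
        using edgeD[OF edge] avoid_uv by (intro edge_stays_inside[OF w Suc.prems(2) es]) auto
    qed
    let ?k = "length p - 1"
    have k: "?k < length p" using ne by simp
    obtain u v i where uvi: "p ! ?k = (u, v, i)" by (metis prod_cases3)
    have "p ! ?k \<in> set es" using k sub listing by (auto simp: edge_listing_def)
    then obtain e where e: "e < length es" "es ! e = p ! ?k" by (metis in_set_conv_nth)
    have "v = z" using last uvi ne by (simp add: last_conv_nth)
    moreover have "es ! e = (u, v, i)" using e(2) uvi by simp
    ultimately have "edge_head w e = num z * L"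
      using live[OF k e uvi] by (simp add: edge_head_def)
    with inside[OF k e] X[OF w] show False by (simp add: min_cut_def)
  qed
qed

end

section \<open>Running time and approximation factor on an arbitrary instance\<close>

lemma (in presented_graph) inputs_input_state: "inputs (input_state G s z t num es)"
proof -
  have "card (edges G) = length es"
    using listing distinct_card unfolding edge_listing_def by metis
  then show ?thesis by (simp add: inputs_def input_state_def array_of_def)
qed

lemma (in presented_graph) separator_program_correct:
  "\<exists>k \<sigma>. exec separator_program (input_state G s z t num es) k \<sigma> \<and>
     k \<le> 100000 * ((card (edges G) + card (verts G) * \<tau>) * card (verts G) * \<tau> ^ 2) \<and>
     ((\<exists>S. temporal_separator G s z t S) \<longrightarrow>
        temporal_separator G s z t (output_set G num \<sigma>) \<and>
        card (output_set G num \<sigma>) \<le> \<tau> ^ 2 * min_separator_size G s z t)"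
proof -
  have m: "card (edges G) = length es"
    using listing distinct_card unfolding edge_listing_def by metis
  have "\<forall>v. arr (input_state G s z t num es) ''sep'' v = 0" by (simp add: input_state_def)
  from separator_program_spec[OF inputs_input_state this] obtain k \<sigma> X where
    run: "exec separator_program (input_state G s z t num es) k \<sigma>"
      "k \<le> 100000 * ((length es + card (verts G) * \<tau>) * card (verts G) * \<tau> ^ 2)"
    and X: "\<forall>w\<in>{1..\<tau>}. small_cut w \<longrightarrow> min_cut w (X w)"
    and sep: "\<forall>v. arr \<sigma> ''sep'' v \<noteq> 0 \<longleftrightarrow> (\<exists>w\<in>{1..\<tau>}. \<exists>a\<in>window_cut w (X w). arc_label a = v)"
    unfolding runs_def by blast
  have out: "output_set G num \<sigma> = cut_verts X"
    unfolding output_set_def cut_verts_def using sep by simp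
  have "temporal_separator G s z t (cut_verts X) \<and>
      card (cut_verts X) \<le> \<tau> ^ 2 * min_separator_size G s z t"
    if S: "temporal_separator G s z t S" for S
  proof -
    have cuts: "min_cut w (X w)" if "w \<in> {1..\<tau>}" for w
      using X that small_cut_of_separator[OF S] by simp
    have "\<exists>k S. temporal_separator G s z t S \<and> card S = k" using S by blast
    \<comment> \<open>The given \<open>S\<close> serves for the separator property; the size bound
      is taken at a smallest separator \<open>S'\<close>, which exists once there is any.\<close>
    from LeastI_ex[OF this] obtain S' where
      "temporal_separator G s z t S'" "card S' = min_separator_size G s z t"
      unfolding min_separator_size_def by blast
    with card_cut_verts[OF cuts this(1)] cut_verts_separator[OF cuts S] show ?thesis by simp
  qed
  then have "(\<exists>S. temporal_separator G s z t S) \<longrightarrow> temporal_separator G s z t (output_set G num \<sigma>) \<and>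
      card (output_set G num \<sigma>) \<le> \<tau> ^ 2 * min_separator_size G s z t"
    unfolding out by (intro impI) (elim exE)
  with run show ?thesis unfolding m by (intro exI[of _ k] exI[of _ \<sigma>] conjI)
qed

lemma temporal_path_distinct_ends: "temporal_path G s z p \<Longrightarrow> s \<noteq> z"
  by (auto simp: temporal_path_def path_verts_def)

text \<open>There is no temporal path at all, since its first and last vertices are distinct. So the
  empty output is a separator, and its size \<open>0\<close> meets any bound.\<close>

lemma separator_program_trivial:
  assumes "temporal_graph G" "z \<in> verts G"
  shows "\<exists>k \<sigma>. exec separator_program (input_state G z z t num es) k \<sigma> \<and>
     k \<le> 100000 * ((card (edges G) + card (verts G) * lifetime G) * card (verts G) * lifetime G ^ 2) \<and>
     temporal_separator G z z t (output_set G num \<sigma>) \<and>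
     card (output_set G num \<sigma>) \<le> lifetime G ^ 2 * min_separator_size G z z t"
proof -
  let ?\<sigma> = "input_state G z z t num es"
  have "bval (Equal (R ''s'') (R ''z'')) ?\<sigma>" by (simp add: input_state_def)
  from exec.CondTrue[OF this exec.Skip, of "layout ;; all_windows"]
  \<comment> \<open>One step for the conditional, three for its test and one for
    \<open>SKIP\<close>.\<close>
  have "exec separator_program ?\<sigma> 5 ?\<sigma>" unfolding separator_program_def by (simp add: numeral_eq_Suc)
  moreover have "5 \<le> 100000 * ((card (edges G) + card (verts G) * lifetime G) * card (verts G) * lifetime G ^ 2)"
  proof -
    have "1 \<le> card (verts G)" "1 \<le> lifetime G"
      using assms by (auto simp: temporal_graph_def Suc_le_eq card_gt_0_iff)
    then have "1 \<le> (card (edges G) + card (verts G) * lifetime G) * card (verts G) * lifetime G ^ 2"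
      by (simp add: Suc_le_eq)
    then show ?thesis by linarith
  qed
  moreover have out: "output_set G num ?\<sigma> = {}" by (simp add: output_set_def input_state_def)
  moreover have "temporal_separator G z z t (output_set G num ?\<sigma>)"
    unfolding out temporal_separator_def by (auto dest: temporal_path_distinct_ends)
  moreover have "card (output_set G num ?\<sigma>) \<le> lifetime G ^ 2 * min_separator_size G z z t"
    unfolding out by simp
  ultimately show ?thesis by (intro exI[of _ 5] exI[of _ ?\<sigma>] conjI)
qed

theorem theorem5:
  "\<exists>(P :: com) (c :: nat).
     \<forall>(G :: nat temporal_graph) (s :: nat) (z :: nat) (t :: nat)
      (num :: nat \<Rightarrow> nat) (es :: (nat \<times> nat \<times> nat) list).
       temporal_graph G \<and> s \<in> verts G \<and> z \<in> verts G \<and> 1 \<le> t \<and>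
       vertex_numbering G num \<and> edge_listing G es \<longrightarrow>
       (\<exists>k \<sigma>. exec P (input_state G s z t num es) k \<sigma> \<and>
          k \<le> c * ((card (edges G) + card (verts G) * lifetime G) * card (verts G) * (lifetime G)^2) \<and>
          ((\<exists>S. temporal_separator G s z t S) \<longrightarrow>
             temporal_separator G s z t (output_set G num \<sigma>) \<and>
             card (output_set G num \<sigma>) \<le> (lifetime G)^2 * min_separator_size G s z t))"
proof (rule exI[of _ separator_program], rule exI[of _ 100000], intro allI impI, elim conjE)
  fix G :: "nat temporal_graph" and s z t :: nat and num es
  assume *: "temporal_graph G" "s \<in> verts G" "z \<in> verts G" "1 \<le> t"
    "vertex_numbering G num" "edge_listing G es"
  show "\<exists>k \<sigma>. exec separator_program (input_state G s z t num es) k \<sigma> \<and>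
    k \<le> 100000 * ((card (edges G) + card (verts G) * lifetime G) * card (verts G) * (lifetime G)^2) \<and>
    ((\<exists>S. temporal_separator G s z t S) \<longrightarrow>
       temporal_separator G s z t (output_set G num \<sigma>) \<and>
       card (output_set G num \<sigma>) \<le> (lifetime G)^2 * min_separator_size G s z t)"
  \<comment> \<open>The locale \<open>presented_graph\<close> covers distinct ends only.\<close>
  proof (cases "s = z")
    case True
    with separator_program_trivial[OF *(1,3), of t num es] show ?thesis by auto
  next
    case False
    with * interpret presented_graph G s z t num es by unfold_locales
    show ?thesis by (rule separator_program_correct)
  qed
qed

end
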